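(* Let $k\ge2$ be an integer and $\varepsilon>0$ a constant. Consider the random graph process $\{G_i\}_{i=0}^{\binom{n}{2}}$ on $n$ vertices and let $\tau_{2k-2}=\min\{m : \delta(G_m)\ge 2k-2\}$ denote the step in which the last vertex of degree at most $2k-3$ disappears. Then with high probability (as $n\to\infty$, with $k$ and $\varepsilon$ fixed) $G_{\tau_{2k-2}}$ is $(1/2-\varepsilon)$-resilient with respect to $k$-connectivity.
   Context: Random graph process: $G_0$ is the empty graph on $n$ vertices; for each $i\in\{1,\dots,\binom n2\}$, $G_i$ is obtained from $G_{i-1}$ by adding an edge $e\notin E(G_{i-1})$ chosen uniformly at random among the missing edges. With high probability: with probability tending to $1$ as $n\to\infty$. $\delta(G)$ denotes the minimum degree of $G$. A graph is $k$-connected if the removal of at most $k-1$ vertices does not disconnect it. $\alpha$-resilience: Let $G=(V,E)$ be a graph, $\mathcal P$ a monotone increasing graph property, and $\alpha$ a real constant. $G$ is $\alpha$-resilient with respect to $\mathcal P$ if for every spanning subgraph $H\subseteq G$ satisfying $\deg_H(v)\le \alpha\deg_G(v)$ for all $v\in V$, we have $G-H\in\mathcal P$, where $G-H$ is the graph on $V$ with edge set $E(G)\setminus E(H)$. *)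

theory Defs
  imports "HOL-Probability.Probability"
begin

text \<open>
  A finite simple graph is given by its vertex set \<open>V\<close> and its edge set \<open>E\<close>, where an edge is a
  two-element subset of \<open>V\<close>.  The vertex set is kept as a separate argument because it is fixed
  along the random graph process and shared by spanning subgraphs.
\<close>

definition all_edges :: "'a set \<Rightarrow> 'a set set" where
  "all_edges V = {e. e \<subseteq> V \<and> card e = 2}"

definition degree :: "'a set set \<Rightarrow> 'a \<Rightarrow> nat" where
  "degree E v = card {e \<in> E. v \<in> e}"

definition min_degree :: "'a set \<Rightarrow> 'a set set \<Rightarrow> nat" where
  "min_degree V E = Min (degree E ` V)"

definition connected_graph :: "'a set \<Rightarrow> 'a set set \<Rightarrow> bool" where
  "connected_graph V E \<longleftrightarrow> (\<forall>u\<in>V. \<forall>v\<in>V. (u, v) \<in> {(x, y). {x, y} \<in> E}\<^sup>*)"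

definition delete_vertices :: "'a set set \<Rightarrow> 'a set \<Rightarrow> 'a set set" where
  "delete_vertices E S = {e \<in> E. e \<inter> S = {}}"

text \<open>
  No lower bound on the number of vertices is imposed, and the empty graph counts as connected;
  both conventions only matter for graphs with at most \<open>k\<close> vertices.
\<close>

definition k_connected :: "nat \<Rightarrow> 'a set \<Rightarrow> 'a set set \<Rightarrow> bool" where
  "k_connected k V E \<longleftrightarrow>
     (\<forall>S. S \<subseteq> V \<and> finite S \<and> card S < k \<longrightarrow> connected_graph (V - S) (delete_vertices E S))"

text \<open>
  Resilience is meant for properties that are monotone increasing in the edge set; the lemma below
  records that \<open>k\<close>-connectivity is one.
\<close>

definition resilient ::
  "real \<Rightarrow> ('a set \<Rightarrow> 'a set set \<Rightarrow> bool) \<Rightarrow> 'a set \<Rightarrow> 'a set set \<Rightarrow> bool" where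
  "resilient \<alpha> P V E \<longleftrightarrow>
     (\<forall>H. H \<subseteq> E \<and> (\<forall>v\<in>V. real (degree H v) \<le> \<alpha> * real (degree E v)) \<longrightarrow> P V (E - H))"

lemma k_connected_mono:
  assumes "E \<subseteq> E'" and "k_connected k V E"
  shows "k_connected k V E'"
proof -
  have "{(x, y). {x, y} \<in> delete_vertices E S}\<^sup>* \<subseteq> {(x, y). {x, y} \<in> delete_vertices E' S}\<^sup>*" for S
    using assms(1) by (intro rtrancl_mono) (auto simp: delete_vertices_def)
  with assms(2) show ?thesis
    unfolding k_connected_def connected_graph_def by blast
qed

text \<open>
  The first \<open>i\<close> steps of the random graph process on \<open>{..<n}\<close>, as the list of edge sets of
  \<open>G\<^sub>0, \<dots>, G\<^sub>i\<close>.  Only \<open>i \<le> n choose 2\<close> is meaningful: beyond that no edge is missing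
  and \<open>pmf_of_set {}\<close> is unspecified.
\<close>

primrec random_graph_steps :: "nat \<Rightarrow> nat \<Rightarrow> nat set set list pmf" where
  "random_graph_steps n 0 = return_pmf [{}]"
| "random_graph_steps n (Suc i) =
     bind_pmf (random_graph_steps n i) (\<lambda>Gs.
       map_pmf (\<lambda>e. Gs @ [insert e (last Gs)]) (pmf_of_set (all_edges {..<n} - last Gs)))"

definition random_graph_process :: "nat \<Rightarrow> nat set set list pmf" where
  "random_graph_process n = random_graph_steps n (n choose 2)"

text \<open>
  The step exists for every full trajectory on more than \<open>d\<close> vertices, since the process ends in
  the complete graph; otherwise the value is unspecified.
\<close>

definition min_degree_time :: "nat \<Rightarrow> 'a set \<Rightarrow> 'a set set list \<Rightarrow> nat" where
  "min_degree_time d V Gs = (LEAST m. m < length Gs \<and> min_degree V (Gs ! m) \<ge> d)"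

end

theory Submission
  imports Defs "HOL-Real_Asymp.Real_Asymp"
begin

text \<open>
  Fix a small \<open>\<eta>\<close> depending on \<open>\<epsilon>\<close> and let \<open>G\<^sub>0 \<subseteq> G\<^sub>1\<close> be the graphs of the process at times
  \<open>(1 \<mp> \<eta>) n ln n / 2\<close>.  With high probability \<open>G\<^sub>0\<close> has an isolated vertex and \<open>G\<^sub>1\<close> has minimum
  degree at least \<open>2k - 2\<close>, so the hitting time graph \<open>G\<close> lies between them, and it inherits from
  this pair that vertices of degree at most \<open>ln n / 100\<close> are pairwise at distance more than two,
  that sets of at most \<open>\<kappa>n\<close> vertices span few edges, and that larger sets \<open>A\<close> have about the
  expected numbers of inner and leaving edges.

  Suppose that \<open>G - H\<close> becomes disconnected after removing fewer than \<open>k\<close> vertices, and let \<open>A\<close> be a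
  part of the separation with at most \<open>n / 2\<close> vertices.  All edges of \<open>G\<close> from \<open>A\<close> to the other part
  belong to \<open>H\<close>, hence they make up at most a \<open>1/2 - \<epsilon>\<close> fraction of the degree sum of \<open>A\<close>.  If \<open>A\<close>
  is large, this contradicts the edge counts.  If \<open>A\<close> is small, its degree sum is much smaller than
  \<open>\<bar>A\<bar> ln n\<close>; but every vertex keeps degree at least \<open>k\<close> in \<open>G - H\<close>, so every low-degree vertex of
  \<open>A\<close> has a neighbour in \<open>A\<close>, and these neighbours are distinct and of high degree.  Thus at least half
  of \<open>A\<close> has high degree, a contradiction.
\<close>

subsection \<open>Trajectories of the random graph process\<close>

lemma finite_all_edges: "finite V \<Longrightarrow> finite (all_edges V)"
  by (rule finite_subset[of _ "Pow V"]) (auto simp: all_edges_def)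

lemma card_all_edges: "finite V \<Longrightarrow> card (all_edges V) = card V choose 2"
  unfolding all_edges_def by (rule n_subsets)

text \<open>Holds of every list in the support. As \<open>card (Gs ! j) = j\<close>, the number of
  missing edges at each step does not depend on the history, so neither do the denominators in the
  one-step averages.\<close>

definition trajectory :: "nat \<Rightarrow> nat \<Rightarrow> nat set set list \<Rightarrow> bool" where
  "trajectory n i Gs \<longleftrightarrow> length Gs = Suc i
     \<and> (\<forall>j\<le>i. Gs ! j \<subseteq> all_edges {..<n} \<and> card (Gs ! j) = j)
     \<and> (\<forall>j<i. Gs ! j \<subseteq> Gs ! Suc j)"

lemma trajectory_last: "trajectory n i Gs \<Longrightarrow> last Gs = Gs ! i"
  by (cases Gs rule: rev_cases) (auto simp: trajectory_def nth_append)

lemma trajectory_mono: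
  assumes "trajectory n i Gs" "a \<le> b" "b \<le> i"
  shows "Gs ! a \<subseteq> Gs ! b"
  using assms(2,3)
proof (induction b rule: dec_induct)
  case (step b)
  then have "Gs ! a \<subseteq> Gs ! b" "Gs ! b \<subseteq> Gs ! Suc b"
    using assms(1) by (auto simp: trajectory_def)
  then show ?case by blast
qed simp

lemma card_missing_edges:
  assumes "trajectory n i Gs"
  shows "card (all_edges {..<n} - last Gs) = (n choose 2) - i"
proof -
  have "last Gs \<subseteq> all_edges {..<n}" "card (last Gs) = i"
    using assms trajectory_last[OF assms] by (auto simp: trajectory_def)
  moreover from this have "finite (last Gs)"
    by (meson finite_all_edges finite_lessThan finite_subset)
  ultimately show ?thesis
    by (simp add: card_Diff_subset card_all_edges)
qed

text \<open>\<open>pmf_of_set\<close> is specified only on finite nonempty sets; this licenses its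
  use at every step of the process.\<close>

lemma missing_edges:
  assumes "trajectory n i Gs" "i < n choose 2"
  shows "finite (all_edges {..<n} - last Gs)" "all_edges {..<n} - last Gs \<noteq> {}"
proof -
  show "finite (all_edges {..<n} - last Gs)" by (simp add: finite_all_edges)
  have "card (all_edges {..<n} - last Gs) \<noteq> 0"
    using card_missing_edges[OF assms(1)] assms(2) by simp
  then show "all_edges {..<n} - last Gs \<noteq> {}" by (metis card.empty)
qed

lemma trajectory_step:
  assumes tr: "trajectory n i Gs" and e: "e \<in> all_edges {..<n} - last Gs"
  shows "trajectory n (Suc i) (Gs @ [insert e (last Gs)])"
proof -
  have fin: "finite (Gs ! i)"
    using tr by (meson finite_all_edges finite_lessThan finite_subset le_refl trajectory_def)
  show ?thesis
    using tr e fin trajectory_last[OF tr] unfolding trajectory_def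
    by (auto simp: nth_append less_Suc_eq le_Suc_eq)
qed

lemma set_random_graph_steps:
  assumes "Gs \<in> set_pmf (random_graph_steps n i)" "i \<le> n choose 2"
  shows "trajectory n i Gs"
  using assms
proof (induction i arbitrary: Gs)
  case 0
  then show ?case by (auto simp: trajectory_def)
next
  case (Suc i)
  then obtain Gs' e where *: "Gs' \<in> set_pmf (random_graph_steps n i)"
      "e \<in> set_pmf (pmf_of_set (all_edges {..<n} - last Gs'))"
      "Gs = Gs' @ [insert e (last Gs')]"
    by auto
  have tr: "trajectory n i Gs'" using Suc * by simp
  have "e \<in> all_edges {..<n} - last Gs'"
    using *(2) missing_edges[OF tr] Suc.prems(2) by simp
  then show ?case using trajectory_step[OF tr] *(3) by simp
qed

lemma finite_set_random_graph_steps: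
  assumes "i \<le> n choose 2"
  shows "finite (set_pmf (random_graph_steps n i))"
  using assms
proof (induction i)
  case (Suc i)
  then show ?case
    using missing_edges[OF set_random_graph_steps[of _ n i]] by auto
qed simp

lemma integrable_random_graph_steps:
  fixes f :: "nat set set list \<Rightarrow> real"
  assumes "i \<le> n choose 2"
  shows "integrable (measure_pmf (random_graph_steps n i)) f"
  by (rule integrable_measure_pmf_finite[OF finite_set_random_graph_steps[OF assms]])

section \<open>Averaging over the next edge\<close>

text \<open>The conditional expectation of \<open>f\<close> one step later, given the history
  \<open>Gs\<close>, written as an explicit average.\<close>

definition step_mean :: "nat \<Rightarrow> (nat set set list \<Rightarrow> real) \<Rightarrow> nat set set list \<Rightarrow> real" where
  "step_mean n f Gs = (\<Sum>e\<in>all_edges {..<n} - last Gs. f (Gs @ [insert e (last Gs)]))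
                        / real (card (all_edges {..<n} - last Gs))"

lemma expectation_step:
  fixes f :: "nat set set list \<Rightarrow> real"
  assumes "i < n choose 2"
  shows "measure_pmf.expectation (random_graph_steps n (Suc i)) f
         = measure_pmf.expectation (random_graph_steps n i) (step_mean n f)"
proof -
  let ?S = "set_pmf (random_graph_steps n i)"
  have tr: "trajectory n i Gs" if "Gs \<in> ?S" for Gs
    using set_random_graph_steps[OF that] assms by simp
  have fin: "finite ?S" using finite_set_random_graph_steps assms by simp
  have "measure_pmf.expectation (random_graph_steps n (Suc i)) f
      = (\<Sum>Gs\<in>?S. pmf (random_graph_steps n i) Gs *\<^sub>R
          measure_pmf.expectation (map_pmf (\<lambda>e. Gs @ [insert e (last Gs)])
            (pmf_of_set (all_edges {..<n} - last Gs))) f)"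
    unfolding random_graph_steps.simps
    by (rule pmf_expectation_bind) (use fin missing_edges[OF tr assms] in auto)
  also have "\<dots> = (\<Sum>Gs\<in>?S. pmf (random_graph_steps n i) Gs * step_mean n f Gs)"
    using missing_edges[OF tr assms]
    by (intro sum.cong refl) (simp add: integral_pmf_of_set step_mean_def)
  also have "\<dots> = measure_pmf.expectation (random_graph_steps n i) (step_mean n f)"
    by (subst integral_measure_pmf_real[of ?S]) (auto simp: fin mult.commute)
  finally show ?thesis .
qed

text \<open>A supermartingale argument: the factors \<open>c i\<close> are constants, so they leave
  the expectation and multiply up. \<open>W\<close> depends on the time so that parts of it can be
  frozen.\<close>

lemma expectation_potential_le:
  fixes W :: "nat \<Rightarrow> nat set set list \<Rightarrow> real" and c :: "nat \<Rightarrow> real"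
  assumes m: "m \<le> n choose 2" and c: "\<And>i. i < m \<Longrightarrow> 0 \<le> c i"
    and step: "\<And>i Gs. i < m \<Longrightarrow> trajectory n i Gs \<Longrightarrow> step_mean n (W (Suc i)) Gs \<le> c i * W i Gs"
  shows "measure_pmf.expectation (random_graph_steps n m) (W m) \<le> (\<Prod>i<m. c i) * W 0 [{}]"
  using m c step
proof (induction m)
  case (Suc m)
  let ?E = "measure_pmf.expectation (random_graph_steps n m)"
  have "measure_pmf.expectation (random_graph_steps n (Suc m)) (W (Suc m))
      = ?E (step_mean n (W (Suc m)))"
    using Suc.prems by (intro expectation_step) simp
  also have "\<dots> \<le> ?E (\<lambda>Gs. c m * W m Gs)"
    using Suc.prems set_random_graph_steps[of _ n m]
    by (intro integral_mono_AE integrable_random_graph_steps) (auto simp: AE_measure_pmf_iff)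
  also have "\<dots> = c m * ?E (W m)" by simp
  also have "\<dots> \<le> c m * ((\<Prod>i<m. c i) * W 0 [{}])"
    using Suc by (intro mult_left_mono) auto
  finally show ?case by (simp add: algebra_simps)
qed simp

text \<open>Adding \<open>e\<close> multiplies the weight by \<open>exp \<mu>\<close> on
  \<open>I\<close>, by \<open>exp (- \<nu>)\<close> on \<open>F\<close> and by \<open>1\<close>
  elsewhere. As \<open>I\<close> and \<open>F\<close> are disjoint, this factor is affine in the two
  indicators, and the sum reduces to counting missing edges of either set; at least
  \<open>card F - l\<close> edges of \<open>F\<close> are still missing.\<close>

lemma sum_missing_le:
  fixes \<mu> \<nu> l :: real
  assumes fin: "finite U" and FU: "F \<subseteq> U" and gU: "g \<subseteq> U" and "I \<inter> F = {}"
    and "0 \<le> \<mu>" "0 \<le> \<nu>" and l: "real (card (F \<inter> g)) \<le> l"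
  shows "(\<Sum>e\<in>U - g. exp (\<mu> * card (I \<inter> insert e g)) * exp (- \<nu> * card (F \<inter> insert e g)))
     \<le> (real (card (U - g)) + (exp \<mu> - 1) * card (I \<inter> U)  - (1 - exp (-\<nu>)) * max 0 (card F - l))
        * (exp (\<mu> * card (I \<inter> g)) * exp (- \<nu> * card (F \<inter> g)))"
proof -
  let ?w = "exp (\<mu> * card (I \<inter> g)) * exp (- \<nu> * card (F \<inter> g))"
  have fg: "finite g" using fin gU finite_subset by blast
  have fF: "finite F" using fin FU finite_subset by blast
  have one: "exp (\<mu> * card (I \<inter> insert e g)) * exp (- \<nu> * card (F \<inter> insert e g))
      = ?w * (1 + (exp \<mu> - 1) * of_bool (e \<in> I) - (1 - exp (-\<nu>)) * of_bool (e \<in> F))"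
    if "e \<in> U - g" for e
  proof -
    have "e \<notin> I \<or> e \<notin> F" using assms(4) by blast
    then show ?thesis using that fg
      by (auto simp: Int_insert_right algebra_simps exp_add exp_minus field_simps)
  qed
  have cF: "real (card (F - g)) \<ge> max 0 (card F - l)"
  proof -
    have "card (F - g) + card (F \<inter> g) = card F"
      using fF by (metis card_Diff_subset_Int add.commute card_mono finite_Int inf_le1 le_add_diff_inverse)
    then show ?thesis using l by simp
  qed
  have cI: "card (I \<inter> (U - g)) \<le> card (I \<inter> U)"
    using fin by (intro card_mono) auto
  have "(\<Sum>e\<in>U - g. exp (\<mu> * card (I \<inter> insert e g)) * exp (- \<nu> * card (F \<inter> insert e g)))
     = ?w * (\<Sum>e\<in>U - g. 1 + (exp \<mu> - 1) * of_bool (e \<in> I) - (1 - exp (-\<nu>)) * of_bool (e \<in> F))"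
    using one by (simp add: sum_distrib_left)
  also have "(\<Sum>e\<in>U - g. 1 + (exp \<mu> - 1) * of_bool (e \<in> I) - (1 - exp (-\<nu>)) * of_bool (e \<in> F))
     = real (card (U - g)) + (exp \<mu> - 1) * card (I \<inter> (U - g)) - (1 - exp (-\<nu>)) * card (F - g)"
  proof -
    have "(U - g) \<inter> {e. e \<in> I} = I \<inter> (U - g)" "(U - g) \<inter> {e. e \<in> F} = F - g" using FU by auto
    then show ?thesis using fin
      by (simp add: sum_subtractf sum.distrib flip: sum_distrib_left)
  qed
  also have "?w * \<dots> \<le> ?w * (real (card (U - g)) + (exp \<mu> - 1) * card (I \<inter> U)  - (1 - exp (-\<nu>)) * max 0 (card F - l))"
    using cF cI assms by (intro mult_left_mono add_mono diff_mono) auto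
  finally show ?thesis by (simp add: mult.commute)
qed

subsection \<open>Tail bounds along the process\<close>

lemma step_mean_const:
  assumes tr: "trajectory n i Gs" and "i < n choose 2"
    and "\<And>e. e \<in> all_edges {..<n} - last Gs \<Longrightarrow> f (Gs @ [insert e (last Gs)]) = C"
  shows "step_mean n f Gs = C"
  using assms missing_edges[OF assms(1,2)] by (simp add: step_mean_def)

text \<open>The number \<open>D\<close> of missing edges lies between \<open>?N - b\<close> and
  \<open>?N\<close>. The gain from \<open>I\<close> is divided by the smaller value, the loss from
  \<open>F\<close> by the larger one, and \<open>1 + x \<le> exp x\<close> finishes. The constant
  \<open>C\<close> carries factors that are already frozen.\<close>

lemma step_mean_potential_le:
  fixes \<mu> \<nu> C l :: real
  assumes tr: "trajectory n i Gs" and i: "i < b" and b: "b < n choose 2"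
    and I: "I \<subseteq> all_edges {..<n}" and F: "F \<subseteq> all_edges {..<n}" and IF: "I \<inter> F = {}"
    and \<mu>: "0 \<le> \<mu>" and \<nu>: "0 \<le> \<nu>" and C: "0 \<le> C" and l: "card (F \<inter> last Gs) \<le> l"
    and le: "\<And>e. e \<in> all_edges {..<n} - last Gs \<Longrightarrow> f (Gs @ [insert e (last Gs)])
       \<le> C * (exp (\<mu> * card (I \<inter> insert e (last Gs))) * exp (- \<nu> * card (F \<inter> insert e (last Gs))))"
  shows "step_mean n f Gs
     \<le> exp ((exp \<mu> - 1) * card I / (real (n choose 2) - b) - (1 - exp (-\<nu>)) * (card F - l) / (n choose 2))
       * (C * (exp (\<mu> * card (I \<inter> last Gs)) * exp (- \<nu> * card (F \<inter> last Gs))))"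
proof -
  let ?U = "all_edges {..<n}" and ?g = "last Gs" and ?N = "real (n choose 2)"
  define w where "w = C * (exp (\<mu> * card (I \<inter> ?g)) * exp (- \<nu> * card (F \<inter> ?g)))"
  define D where "D = real (card (?U - ?g))"
  have gU: "?g \<subseteq> ?U" using tr trajectory_last[OF tr] by (auto simp: trajectory_def)
  have D: "D = ?N - i" using card_missing_edges[OF tr] i b by (simp add: D_def of_nat_diff)
  have w: "0 \<le> w" using C by (simp add: w_def)
  have *: "(\<Sum>e\<in>?U - ?g. f (Gs @ [insert e ?g]))
    \<le> (D + (exp \<mu> - 1) * card I - (1 - exp (-\<nu>)) * max 0 (card F - l)) * w"
  proof -
    have "(\<Sum>e\<in>?U - ?g. f (Gs @ [insert e ?g]))
      \<le> C * (\<Sum>e\<in>?U - ?g. exp (\<mu> * card (I \<inter> insert e ?g)) * exp (- \<nu> * card (F \<inter> insert e ?g)))"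
      unfolding sum_distrib_left using le by (rule sum_mono)
    also have "\<dots> \<le> C * ((D + (exp \<mu> - 1) * card (I \<inter> ?U) - (1 - exp (-\<nu>)) * max 0 (card F - l))
        * (exp (\<mu> * card (I \<inter> ?g)) * exp (- \<nu> * card (F \<inter> ?g))))"
      unfolding D_def
      by (rule mult_left_mono[OF sum_missing_le[OF _ F gU IF \<mu> \<nu> l] C]) (simp add: finite_all_edges)
    also have "I \<inter> ?U = I" using I by auto
    finally show ?thesis by (simp add: w_def mult_ac)
  qed
  have Dpos: "0 < D" "0 < ?N - b" "0 < ?N" "D \<le> ?N" "?N - b \<le> D"
    using i b unfolding D by linarith+
  have "step_mean n f Gs \<le> (D + (exp \<mu> - 1) * card I - (1 - exp (-\<nu>)) * max 0 (card F - l)) * w / D"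
    unfolding step_mean_def D_def[symmetric] using * Dpos by (simp add: divide_right_mono)
  also have "\<dots> = (1 + (exp \<mu> - 1) * card I / D - (1 - exp (-\<nu>)) * max 0 (card F - l) / D) * w"
    using Dpos by (simp add: field_simps)
  \<comment> \<open>Replacing \<open>D\<close> by \<open>?N\<close> weakens the loss because the
    \<open>max\<close> keeps its numerator nonnegative; after that the \<open>max\<close> can
    go.\<close>
  also have "\<dots> \<le> (1 + (exp \<mu> - 1) * card I / (?N - b) - (1 - exp (-\<nu>)) * max 0 (card F - l) / ?N) * w"
    using Dpos w \<mu> \<nu>
    by (intro mult_right_mono add_mono diff_mono divide_left_mono mult_nonneg_nonneg mult_pos_pos) auto
  also have "\<dots> \<le> (1 + (exp \<mu> - 1) * card I / (?N - b) - (1 - exp (-\<nu>)) * (card F - l) / ?N) * w"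
    using Dpos w \<nu> by (intro mult_right_mono add_mono diff_mono divide_right_mono mult_left_mono) auto
  also have "\<dots> \<le> exp ((exp \<mu> - 1) * card I / (?N - b) - (1 - exp (-\<nu>)) * (card F - l) / ?N) * w"
    using exp_ge_add_one_self[of "(exp \<mu> - 1) * card I / (?N - b) - (1 - exp (-\<nu>)) * (card F - l) / ?N"] w
    by (intro mult_right_mono) (simp only: diff_conv_add_uminus add.assoc)
  finally show ?thesis by (simp add: w_def)
qed

text \<open>
  The quantity \<open>exp (\<mu>\<bar>I \<inter> G\<^sub>i\<bar> - \<nu>\<bar>F \<inter> G\<^sub>i\<bar>)\<close>, set to \<open>0\<close> once \<open>\<bar>F \<inter> G\<^sub>i\<bar> > l\<close>, changes in one step by
  at most a deterministic factor in the mean, because \<open>F\<close> still has at least \<open>\<bar>F\<bar> - l\<close> missing edges.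
  The set \<open>F\<close> is frozen after time \<open>a\<close> and \<open>I\<close> after time \<open>b\<close>; Markov's inequality does the rest.
\<close>

theorem process_tail:
  fixes \<mu> \<nu> l x :: real
  assumes ab: "a \<le> b" "b < n choose 2"
    and I: "I \<subseteq> all_edges {..<n}" and F: "F \<subseteq> all_edges {..<n}" and IF: "I \<inter> F = {}"
    and \<mu>: "0 \<le> \<mu>" and \<nu>: "0 \<le> \<nu>"
  shows "measure_pmf.prob (random_graph_process n)
      {Gs. x \<le> card (I \<inter> Gs ! b) \<and> card (F \<inter> Gs ! a) \<le> l}
    \<le> exp (- \<mu> * x + (exp \<mu> - 1) * card I * (b / (real (n choose 2) - b))
          + \<nu> * l - (1 - exp (-\<nu>)) * (card F - l) * (a / (n choose 2)))"
proof (cases "0 \<le> l")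
  case False
  then have empty: "{Gs. x \<le> card (I \<inter> Gs ! b) \<and> card (F \<inter> Gs ! a) \<le> l} = {}"
    by (smt (verit) Collect_empty_eq of_nat_0_le_iff)
  show ?thesis unfolding empty by simp
next
  case l0: True
  let ?N = "n choose 2"
  let ?x = "(exp \<mu> - 1) * card I / (real ?N - b)"
  let ?y = "(1 - exp (-\<nu>)) * (card F - l) / ?N"
  define W where "W = (\<lambda>i Gs. (if card (F \<inter> Gs ! min i a) \<le> l then
      exp (\<mu> * card (I \<inter> Gs ! min i b)) * exp (- \<nu> * card (F \<inter> Gs ! min i a)) else 0))"
  define c where "c = (\<lambda>i. if i < a then exp (?x - ?y) else if i < b then exp ?x else 1)"
  have step: "step_mean n (W (Suc i)) Gs \<le> c i * W i Gs"
    if i: "i < ?N" and tr: "trajectory n i Gs" for i Gs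
  proof -
    let ?g = "last Gs"
    have len: "length Gs = Suc i" using tr by (simp add: trajectory_def)
    have g: "?g = Gs ! i" using trajectory_last[OF tr] .
    have gU: "?g \<subseteq> all_edges {..<n}" using tr g by (auto simp: trajectory_def)
    have new: "(Gs @ [insert e ?g]) ! Suc i = insert e ?g" for e using len by (simp add: nth_append)
    have old: "(Gs @ [insert e ?g]) ! j = Gs ! j" if "j \<le> i" for e j
      using len that by (simp add: nth_append)
    consider "i < a" "card (F \<inter> ?g) \<le> l" | "i < a" "\<not> card (F \<inter> ?g) \<le> l"
      | "a \<le> i" "i < b" "card (F \<inter> Gs ! a) \<le> l" | "a \<le> i" "\<not> card (F \<inter> Gs ! a) \<le> l"
      | "b \<le> i" using ab by linarith
    then show ?thesis
    proof cases
      case 1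
      have "step_mean n (W (Suc i)) Gs \<le> exp (?x - ?y)
        * (1 * (exp (\<mu> * card (I \<inter> ?g)) * exp (- \<nu> * card (F \<inter> ?g))))"
        using 1 ab by (intro step_mean_potential_le[OF tr _ ab(2) I F IF \<mu> \<nu>]) (auto simp: W_def new)
      then show ?thesis using 1 ab g by (simp add: W_def c_def)
    next
      case 2
      have fin: "finite (F \<inter> insert e ?g)" for e
        using F by (meson finite_Int finite_all_edges finite_lessThan finite_subset)
      \<comment> \<open>The intersection with \<open>F\<close> only grows, so a potential that has
        been cut off stays \<open>0\<close>.\<close>
      have "\<not> card (F \<inter> insert e ?g) \<le> l" for e
        using 2 card_mono[OF fin, of "F \<inter> ?g" e] by fastforce
      then have "step_mean n (W (Suc i)) Gs = 0"
        using 2 by (intro step_mean_const[OF tr i]) (simp add: W_def new)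
      then show ?thesis by (simp add: W_def c_def)
    next
      case 3
      \<comment> \<open>Between \<open>a\<close> and \<open>b\<close> the \<open>F\<close>-part is
        the constant \<open>C\<close>, and the one-step bound is applied with the empty set in the
        place of \<open>F\<close>; what remains is the factor \<open>exp ?x\<close>.\<close>
      have "step_mean n (W (Suc i)) Gs \<le> exp (?x - (1 - exp (- (0::real))) * (card ({} :: nat set set) - (0::real)) / ?N)
        * (exp (- \<nu> * card (F \<inter> Gs ! a))
            * (exp (\<mu> * card (I \<inter> ?g)) * exp (- (0::real) * card ({} \<inter> ?g))))"
        using 3 ab by (intro step_mean_potential_le[OF tr _ ab(2) I _ _ \<mu>]) (auto simp: W_def new old)
      then show ?thesis using 3 ab g by (simp add: W_def c_def mult_ac)
    next
      case 4
      then have "step_mean n (W (Suc i)) Gs = 0"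
        by (intro step_mean_const[OF tr i]) (simp add: W_def old)
      then show ?thesis by (simp add: W_def c_def)
    next
      case 5
      then have "step_mean n (W (Suc i)) Gs = W i Gs"
        using ab by (intro step_mean_const[OF tr i]) (simp add: W_def old)
      then show ?thesis using 5 ab by (simp add: c_def)
    qed
  qed
  let ?A = "{Gs. x \<le> card (I \<inter> Gs ! b) \<and> card (F \<inter> Gs ! a) \<le> l}"
  have "exp (\<mu> * x - \<nu> * l) * measure_pmf.prob (random_graph_process n) ?A
      = measure_pmf.expectation (random_graph_process n) (\<lambda>Gs. exp (\<mu> * x - \<nu> * l) * indicator ?A Gs)"
    by simp
  also have "\<dots> \<le> measure_pmf.expectation (random_graph_process n) (W ?N)"
  proof (rule integral_mono)
    show "exp (\<mu> * x - \<nu> * l) * indicator ?A Gs \<le> W ?N Gs" for Gs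
    proof (cases "Gs \<in> ?A")
      case True
      then have "\<mu> * x \<le> \<mu> * card (I \<inter> Gs ! b)" "\<nu> * card (F \<inter> Gs ! a) \<le> \<nu> * l"
        using \<mu> \<nu> by (auto intro: mult_left_mono)
      then have "exp (\<mu> * x - \<nu> * l) \<le> exp (\<mu> * card (I \<inter> Gs ! b) + - \<nu> * card (F \<inter> Gs ! a))"
        by simp
      then show ?thesis using True ab by (simp add: W_def flip: exp_add)
    qed (simp add: W_def)
  qed (auto simp: random_graph_process_def intro!: integrable_random_graph_steps)
  also have "\<dots> \<le> (\<Prod>i<?N. c i) * W 0 [{}]"
    unfolding random_graph_process_def
    by (intro expectation_potential_le step) (auto simp: c_def)
  also have "W 0 [{}] = 1" using l0 by (simp add: W_def)
  also have "(\<Prod>i<?N. c i) = exp (b * ?x - a * ?y)"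
  proof -
    have "(\<Prod>i<?N. c i) = (\<Prod>i<?N. exp ((if i < b then ?x else 0) - (if i < a then ?y else 0)))"
      using ab by (intro prod.cong) (auto simp: c_def)
    also have "\<dots> = exp (\<Sum>i<?N. (if i < b then ?x else 0) - (if i < a then ?y else 0))"
      by (simp add: exp_sum)
    also have "(\<Sum>i<?N. (if i < b then ?x else 0) - (if i < a then ?y else 0)) = b * ?x - a * ?y"
    proof -
      have "{..<?N} \<inter> {i. i < b} = {..<b}" "{..<?N} \<inter> {i. i < a} = {..<a}" using ab by auto
      then show ?thesis by (simp add: sum_subtractf sum.If_cases del: sum_constant) simp
    qed
    finally show ?thesis .
  qed
  finally have "exp (\<mu> * x - \<nu> * l) * measure_pmf.prob (random_graph_process n) ?A \<le> exp (b * ?x - a * ?y)"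
    by simp
  then have "measure_pmf.prob (random_graph_process n) ?A
      \<le> exp (b * ?x - a * ?y) / exp (\<mu> * x - \<nu> * l)"
    by (simp add: field_simps)
  also have "\<dots> = exp ((b * ?x - a * ?y) - (\<mu> * x - \<nu> * l))" by (simp add: exp_diff)
  also have "(b * ?x - a * ?y) - (\<mu> * x - \<nu> * l)
      = - \<mu> * x + (exp \<mu> - 1) * card I * (b / (real ?N - b))
        + \<nu> * l - (1 - exp (-\<nu>)) * (card F - l) * (a / ?N)"
  proof -
    have swap: "p * (q / r) = q * (p / r)" for p q r :: real by simp
    have rearrange: "p - q - (\<mu> * x - r) = - \<mu> * x + p + r - q" for p q r :: real by simp
    show ?thesis unfolding swap[of "real b"] swap[of "real a"] by (rule rearrange)
  qed
  finally show ?thesis .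
qed

corollary process_upper_tail:
  fixes \<mu> x :: real
  assumes "b < n choose 2" "I \<subseteq> all_edges {..<n}" "0 \<le> \<mu>"
  shows "measure_pmf.prob (random_graph_process n) {Gs. x \<le> card (I \<inter> Gs ! b)}
    \<le> exp (- \<mu> * x + (exp \<mu> - 1) * card I * (b / (real (n choose 2) - b)))"
  using process_tail[of b b n I "{}" \<mu> 0 x 0] assms by simp

corollary process_lower_tail:
  fixes \<nu> l :: real
  assumes "a < n choose 2" "F \<subseteq> all_edges {..<n}" "0 \<le> \<nu>"
  shows "measure_pmf.prob (random_graph_process n) {Gs. card (F \<inter> Gs ! a) \<le> l}
    \<le> exp (\<nu> * l - (1 - exp (-\<nu>)) * (card F - l) * (a / (n choose 2)))"
  using process_tail[of a a n "{}" F 0 \<nu> 0 l] assms by simp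

text \<open>While no edge of \<open>F\<close> has appeared, all of them are missing, so the chance
  that the next edge avoids \<open>F\<close> is determined by \<open>i\<close> alone and the
  indicator picks up an exact factor per step. Equality matters because the second moment method
  compares two such products.\<close>

lemma prob_avoid:
  fixes F :: "nat set set"
  assumes F: "F \<subseteq> all_edges {..<n}" and a: "a + card F \<le> n choose 2"
  shows "measure_pmf.prob (random_graph_process n) {Gs. F \<inter> Gs ! a = {}}
    = (\<Prod>i<a. (real (n choose 2) - real i - card F) / (real (n choose 2) - real i))"
proof -
  let ?N = "n choose 2"
  define W where "W = (\<lambda>i Gs. (if F \<inter> Gs ! min i a = {} then 1 else 0) :: real)"
  define c where "c = (\<lambda>i. if i < a then (real ?N - i - card F) / (real ?N - i) else 1)"
  have step: "step_mean n (W (Suc i)) Gs = c i * W i Gs"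
    if i: "i < ?N" and tr: "trajectory n i Gs" for i Gs
  proof -
    let ?g = "last Gs" and ?U = "all_edges {..<n}"
    have len: "length Gs = Suc i" using tr by (simp add: trajectory_def)
    have g: "?g = Gs ! i" using trajectory_last[OF tr] .
    have gU: "?g \<subseteq> ?U" using tr g by (auto simp: trajectory_def)
    have new: "(Gs @ [insert e ?g]) ! Suc i = insert e ?g" for e using len by (simp add: nth_append)
    have old: "(Gs @ [insert e ?g]) ! j = Gs ! j" if "j \<le> i" for e j
      using len that by (simp add: nth_append)
    consider "i < a" "F \<inter> ?g = {}" | "i < a" "F \<inter> ?g \<noteq> {}" | "a \<le> i" by linarith
    then show ?thesis
    proof cases
      case 1
      have fin: "finite ?U" "finite F"
        using F by (simp_all add: finite_all_edges finite_subset[OF F])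
      have FU: "F \<subseteq> ?U - ?g" using F 1 by auto
      have "(\<Sum>e\<in>?U - ?g. W (Suc i) (Gs @ [insert e ?g])) = (\<Sum>e\<in>?U - ?g. if e \<in> - F then 1 else 0)"
        using 1 by (intro sum.cong) (auto simp: W_def new)
      also have "\<dots> = real (card ((?U - ?g) \<inter> - F))"
        using fin by (simp add: sum.If_cases Compl_eq)
      also have "(?U - ?g) \<inter> - F = (?U - ?g) - F" by auto
      also have "card \<dots> = card (?U - ?g) - card F" using FU fin by (intro card_Diff_subset) auto
      finally have "step_mean n (W (Suc i)) Gs = real (?N - i - card F) / real (?N - i)"
        by (simp add: step_mean_def card_missing_edges[OF tr])
      then show ?thesis
        using 1 g a i by (simp add: c_def W_def of_nat_diff)
    next
      case 2
      then have "F \<inter> insert e ?g \<noteq> {}" for e by auto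
      then have "step_mean n (W (Suc i)) Gs = 0"
        using 2 by (intro step_mean_const[OF tr i]) (simp add: W_def new)
      then show ?thesis using 2 g by (simp add: W_def c_def)
    next
      case 3
      then have "step_mean n (W (Suc i)) Gs = W i Gs"
        by (intro step_mean_const[OF tr i]) (simp add: W_def old)
      then show ?thesis using 3 by (simp add: c_def)
    qed
  qed
  have eq: "measure_pmf.expectation (random_graph_steps n m) (W m) = (\<Prod>i<m. c i)" if "m \<le> ?N" for m
    using that
  proof (induction m)
    case (Suc m)
    have "measure_pmf.expectation (random_graph_steps n (Suc m)) (W (Suc m))
       = measure_pmf.expectation (random_graph_steps n m) (step_mean n (W (Suc m)))"
      using Suc by (intro expectation_step) simp
    also have "\<dots> = measure_pmf.expectation (random_graph_steps n m) (\<lambda>Gs. c m * W m Gs)"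
      using Suc.prems set_random_graph_steps[of _ n m]
      by (intro integral_cong_AE) (auto simp: AE_measure_pmf_iff step)
    finally show ?case using Suc by (simp add: mult.commute)
  qed (simp add: W_def)
  have "measure_pmf.prob (random_graph_process n) {Gs. F \<inter> Gs ! a = {}}
    = measure_pmf.expectation (random_graph_process n) (indicator {Gs. F \<inter> Gs ! a = {}})" by simp
  also have "indicator {Gs. F \<inter> Gs ! a = {}} = W ?N"
    using a by (auto simp: W_def fun_eq_iff indicator_def)
  also have "measure_pmf.expectation (random_graph_process n) (W ?N) = (\<Prod>i<?N. c i)"
    unfolding random_graph_process_def by (rule eq) simp
  also have "\<dots> = (\<Prod>i<a. c i)"
    using a by (intro prod.mono_neutral_right) (auto simp: c_def)
  finally show ?thesis by (simp add: c_def)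
qed

subsection \<open>A deterministic criterion for resilience\<close>

text \<open>Serves to shrink \<open>\<epsilon>\<close> in the final proof, where the estimates need
  it small.\<close>

lemma resilient_antimono:
  assumes "\<alpha> \<le> \<beta>" "resilient \<beta> P V E"
  shows "resilient \<alpha> P V E"
  unfolding resilient_def
proof (intro allI impI)
  fix H assume H: "H \<subseteq> E \<and> (\<forall>v\<in>V. real (degree H v) \<le> \<alpha> * real (degree E v))"
  have "real (degree H v) \<le> \<beta> * real (degree E v)" if "v \<in> V" for v
    using H that assms(1) by (meson mult_right_mono of_nat_0_le_iff order.trans)
  with H assms(2) show "P V (E - H)" unfolding resilient_def by blast
qed

section \<open>Cuts and degree sums\<close>

text \<open>For \<open>u = v\<close> the set \<open>{u, v}\<close> collapses to a singleton; the
  cuts below are between disjoint sets, where every member is a genuine pair.\<close>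

definition cut :: "'a set \<Rightarrow> 'a set \<Rightarrow> 'a set set" where
  "cut A B = {e. \<exists>u\<in>A. \<exists>v\<in>B. e = {u, v}}"

lemma card_cut:
  assumes "finite A" "finite B" "A \<inter> B = {}"
  shows "card (cut A B) = card A * card B"
proof -
  have "cut A B = (\<lambda>(u, v). {u, v}) ` (A \<times> B)" by (auto simp: cut_def)
  moreover have "inj_on (\<lambda>(u, v). {u, v}) (A \<times> B)"
    using assms(3) by (auto simp: inj_on_def doubleton_eq_iff)
  ultimately show ?thesis by (simp add: card_image card_cartesian_product)
qed

lemma cut_subset_all_edges:
  assumes "A \<subseteq> V" "B \<subseteq> V" "A \<inter> B = {}"
  shows "cut A B \<subseteq> all_edges V"
proof
  fix e assume "e \<in> cut A B"
  then obtain u v where "u \<in> A" "v \<in> B" "e = {u, v}" by (auto simp: cut_def)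
  moreover from this have "u \<noteq> v" using assms(3) by auto
  ultimately show "e \<in> all_edges V" using assms by (auto simp: all_edges_def)
qed

lemma all_edges_mono: "A \<subseteq> V \<Longrightarrow> all_edges A \<subseteq> all_edges V"
  by (auto simp: all_edges_def)

text \<open>Double counting of incidences \<open>v \<in> e\<close> with \<open>v \<in> A\<close>: an
  edge contributes \<open>card (A \<inter> e)\<close>, which is 2 inside \<open>A\<close>, 1 across
  its boundary and 0 elsewhere.\<close>

lemma sum_degree:
  assumes V: "finite V" and E: "E \<subseteq> all_edges V" and A: "A \<subseteq> V"
  shows "(\<Sum>v\<in>A. degree E v) = 2 * card (all_edges A \<inter> E) + card (cut A (V - A) \<inter> E)"
proof -
  have finE: "finite E" using E V by (meson finite_all_edges finite_subset)
  have finA: "finite A" using A V finite_subset by blast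
  have split: "E = {e\<in>E. e \<inter> A = {}} \<union> (all_edges A \<inter> E) \<union> (cut A (V - A) \<inter> E)"
  proof (intro equalityI subsetI)
    fix e assume e: "e \<in> E"
    then obtain u v where uv: "e = {u, v}" "u \<noteq> v" "u \<in> V" "v \<in> V"
      using E by (auto simp: all_edges_def card_2_iff)
    show "e \<in> {e\<in>E. e \<inter> A = {}} \<union> (all_edges A \<inter> E) \<union> (cut A (V - A) \<inter> E)"
      using e uv by (cases "u \<in> A"; cases "v \<in> A") (auto simp: all_edges_def cut_def)
  qed auto
  have deg: "degree E v = (\<Sum>e\<in>E. of_bool (v \<in> e))" for v
    using finE by (simp add: degree_def Int_def)
  have "(\<Sum>v\<in>A. degree E v) = (\<Sum>e\<in>E. \<Sum>v\<in>A. of_bool (v \<in> e))"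
    unfolding deg by (rule sum.swap)
  also have "\<dots> = (\<Sum>e\<in>E. card (A \<inter> e))"
    using finA by (simp add: Int_def)
  also have "\<dots> = (\<Sum>e\<in>{e\<in>E. e \<inter> A = {}} \<union> (all_edges A \<inter> E) \<union> (cut A (V - A) \<inter> E). card (A \<inter> e))"
    using split by simp
  also have "\<dots> = (\<Sum>e\<in>{e\<in>E. e \<inter> A = {}} \<union> (all_edges A \<inter> E). card (A \<inter> e)) + (\<Sum>e\<in>cut A (V - A) \<inter> E. card (A \<inter> e))"
    using finE by (intro sum.union_disjoint) (auto simp: cut_def all_edges_def)
  also have "(\<Sum>e\<in>{e\<in>E. e \<inter> A = {}} \<union> (all_edges A \<inter> E). card (A \<inter> e))
    = (\<Sum>e\<in>{e\<in>E. e \<inter> A = {}}. card (A \<inter> e)) + (\<Sum>e\<in>all_edges A \<inter> E. card (A \<inter> e))"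
    using finE by (intro sum.union_disjoint) (auto simp: all_edges_def card_2_iff)
  also have "(\<Sum>e\<in>{e\<in>E. e \<inter> A = {}}. card (A \<inter> e)) = 0" by (simp add: Int_commute)
  also have "(\<Sum>e\<in>all_edges A \<inter> E. card (A \<inter> e)) = (\<Sum>e\<in>all_edges A \<inter> E. 2)"
    by (intro sum.cong refl) (auto simp: all_edges_def Int_absorb1)
  also have "(\<Sum>e\<in>cut A (V - A) \<inter> E. card (A \<inter> e)) = (\<Sum>e\<in>cut A (V - A) \<inter> E. 1)"
    by (intro sum.cong refl) (auto simp: cut_def)
  finally show ?thesis by simp
qed

text \<open>The set reachable from \<open>u\<close> is closed under edges, so no edge joins it to
  its complement in \<open>W\<close>. Both are nonempty, and one of them has at most half the size
  of \<open>V\<close>.\<close>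

lemma small_separated_set:
  assumes V: "finite V" and nc: "\<not> connected_graph W E" and W: "W \<subseteq> V" and E: "E \<subseteq> all_edges W"
  obtains A where "A \<subseteq> W" "A \<noteq> {}" "2 * card A \<le> card V" "cut A (W - A) \<inter> E = {}"
proof -
  let ?R = "{(x, y). {x, y} \<in> E}"
  obtain u v where uv: "u \<in> W" "v \<in> W" "(u, v) \<notin> ?R\<^sup>*"
    using nc by (auto simp: connected_graph_def)
  define A where "A = {x\<in>W. (u, x) \<in> ?R\<^sup>*}"
  have cutA: "cut A (W - A) \<inter> E = {}"
  proof -
    { fix x y assume "x \<in> A" "y \<in> W - A" "{x, y} \<in> E"
      then have "(u, y) \<in> ?R\<^sup>*" unfolding A_def by (auto intro: rtrancl_into_rtrancl)
      with \<open>y \<in> W - A\<close> have False by (simp add: A_def) }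
    then show ?thesis by (auto simp: cut_def)
  qed
  have finW: "finite W" using V W finite_subset by blast
  have AW: "A \<subseteq> W" by (auto simp: A_def)
  have "card A + card (W - A) = card W"
    using AW finW by (metis card_Diff_subset card_mono finite_subset le_add_diff_inverse)
  moreover have "card W \<le> card V" using V W by (rule card_mono)
  ultimately consider "2 * card A \<le> card V" | "2 * card (W - A) \<le> card V" by linarith
  then show ?thesis
  proof cases
    case 1
    have "A \<noteq> {}" using uv by (auto simp: A_def)
    then show ?thesis using that[of A] AW 1 cutA by blast
  next
    case 2
    have "W - (W - A) = A" using AW by auto
    then have "cut (W - A) (W - (W - A)) \<inter> E = {}"
      using cutA by (auto simp: cut_def insert_commute)
    moreover have "W - A \<noteq> {}" using uv by (auto simp: A_def)
    ultimately show ?thesis using that[of "W - A"] 2 by blast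
  qed
qed

text \<open>The graph \<open>G\<close> is sandwiched: lower bounds refer to \<open>G0\<close> and
  upper bounds to \<open>G1\<close>, which can be taken at fixed times although the hitting time is
  random. The predicate \<open>large\<close> splits the cases; \<open>L\<close> stands for
  \<open>ln n\<close>, \<open>\<gamma> * L\<close> is the low-degree threshold and
  \<open>\<delta> * L\<close> the density allowed in small sets.\<close>

theorem resilientI:
  fixes V :: "'a set" and \<epsilon> \<gamma> \<delta> L :: real
  assumes V: "finite V" and G: "G \<subseteq> all_edges V" and G0: "G0 \<subseteq> G" and G1: "G \<subseteq> G1"
    and k: "k \<ge> 2" and eps: "0 < \<epsilon>" "\<epsilon> \<le> 1/2"
    and mindeg: "\<And>v. v \<in> V \<Longrightarrow> 2 * k - 2 \<le> degree G v"
    and nonadj: "\<And>u v. u \<in> V \<Longrightarrow> v \<in> V \<Longrightarrow> u \<noteq> v \<Longrightarrow> degree G0 u \<le> \<gamma> * L \<Longrightarrow>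
       degree G0 v \<le> \<gamma> * L \<Longrightarrow> {u, v} \<notin> G1"
    and noncommon: "\<And>u v w. u \<in> V \<Longrightarrow> v \<in> V \<Longrightarrow> u \<noteq> v \<Longrightarrow> degree G0 u \<le> \<gamma> * L \<Longrightarrow>
       degree G0 v \<le> \<gamma> * L \<Longrightarrow> {u, w} \<in> G1 \<Longrightarrow> {v, w} \<notin> G1"
    and sparse: "\<And>A. A \<subseteq> V \<Longrightarrow> A \<noteq> {} \<Longrightarrow> \<not> large A \<Longrightarrow> card (all_edges A \<inter> G1) \<le> \<delta> * card A * L"
    and expand: "\<And>A. A \<subseteq> V \<Longrightarrow> large A \<Longrightarrow> 2 * card A \<le> card V \<Longrightarrow>
       (1 - 2 * \<epsilon>) * card (all_edges A \<inter> G1) + (real k - 1) * card A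
         < (1/2 + \<epsilon>) * card (cut A (V - A) \<inter> G0)"
    and L: "2 * (real k - 1) \<le> \<delta> * L" and \<gamma>: "10 * \<delta> \<le> \<gamma>" "0 < \<gamma>" "0 < L"
  shows "resilient (1/2 - \<epsilon>) (k_connected k) V G"
proof (unfold resilient_def k_connected_def, intro allI impI, rule ccontr)
  fix H S
  assume H: "H \<subseteq> G \<and> (\<forall>v\<in>V. real (degree H v) \<le> (1/2 - \<epsilon>) * real (degree G v))"
    and S: "S \<subseteq> V \<and> finite S \<and> card S < k"
    and nc: "\<not> connected_graph (V - S) (delete_vertices (G - H) S)"
  have "delete_vertices (G - H) S \<subseteq> all_edges (V - S)"
    using G by (auto simp: delete_vertices_def all_edges_def)
  then obtain A where A: "A \<subseteq> V - S" "A \<noteq> {}" "2 * card A \<le> card V"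
      and cutA: "cut A (V - S - A) \<inter> delete_vertices (G - H) S = {}"
    using small_separated_set[OF V nc] by blast
  have AV: "A \<subseteq> V" using A by auto
  have fin: "finite A" "finite G" "finite H" "finite G0"
    using AV V G H G0 finite_all_edges[OF V] by (meson finite_subset)+
  have cardA: "card A > 0" using A fin by (simp add: card_gt_0_iff)
  have cutH: "cut A (V - S - A) \<inter> G \<subseteq> H"
  proof
    fix e assume e: "e \<in> cut A (V - S - A) \<inter> G"
    have "e \<inter> S = {}" using e A by (auto simp: cut_def)
    then show "e \<in> H" using e cutA by (auto simp: delete_vertices_def)
  qed
  have HV: "H \<subseteq> all_edges V" using H G by auto
  define e where "e = real (card (all_edges A \<inter> G))"
  define c where "c = real (card (cut A (V - A) \<inter> G))"
  define a where "a = real (card A)"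
  have degG: "(\<Sum>v\<in>A. real (degree G v)) = 2 * e + c"
    using sum_degree[OF V G AV] by (simp add: e_def c_def flip: of_nat_sum)
  have degH: "real (card (cut A (V - A) \<inter> H)) \<le> (\<Sum>v\<in>A. real (degree H v))"
    using sum_degree[OF V HV AV] by (simp flip: of_nat_sum)
  have k1: "real (k - 1) = real k - 1" using k by (simp add: of_nat_diff)
  \<comment> \<open>An edge leaving \<open>A\<close> either ends in \<open>S\<close>, which allows
    at most \<open>card A * (k - 1)\<close> edges, or reaches the other side and lies in
    \<open>H\<close>.\<close>
  have cS: "c \<le> card (cut A (V - A) \<inter> H) + (real k - 1) * a"
  proof -
    have "cut A (V - A) \<inter> G \<subseteq> (cut A (V - A) \<inter> H) \<union> cut A S"
    proof
      fix e assume e: "e \<in> cut A (V - A) \<inter> G"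
      then obtain u v where uv: "u \<in> A" "v \<in> V - A" "e = {u, v}" by (auto simp: cut_def)
      show "e \<in> (cut A (V - A) \<inter> H) \<union> cut A S"
      proof (cases "v \<in> S")
        case False
        then have "e \<in> cut A (V - S - A)" using uv by (auto simp: cut_def)
        then show ?thesis using cutH e by auto
      qed (use uv in \<open>auto simp: cut_def\<close>)
    qed
    moreover have "finite (cut A S)"
      by (rule finite_subset[of _ "Pow (A \<union> S)"]) (use fin S in \<open>auto simp: cut_def\<close>)
    ultimately have "card (cut A (V - A) \<inter> G) \<le> card ((cut A (V - A) \<inter> H) \<union> cut A S)"
      using fin by (intro card_mono) auto
    also have "\<dots> \<le> card (cut A (V - A) \<inter> H) + card (cut A S)" by (rule card_Un_le)
    also have "card (cut A S) = card A * card S"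
      using A S fin by (intro card_cut) auto
    also have "\<dots> \<le> card A * (k - 1)" using S by (intro mult_left_mono) auto
    finally have "real (card (cut A (V - A) \<inter> G)) \<le> real (card (cut A (V - A) \<inter> H) + card A * (k - 1))"
      by (simp only: of_nat_le_iff)
    then show ?thesis using k1 by (simp add: c_def a_def mult.commute)
  qed
  have "(\<Sum>v\<in>A. real (degree H v)) \<le> (1/2 - \<epsilon>) * (2 * e + c)"
    unfolding degG[symmetric] sum_distrib_left using H AV by (intro sum_mono) auto
  then have main: "c \<le> (1/2 - \<epsilon>) * (2 * e + c) + (real k - 1) * a"
    using degH cS by linarith
  have e1: "e \<le> card (all_edges A \<inter> G1)"
    unfolding e_def using G1 fin finite_all_edges[of A] by (intro of_nat_mono card_mono) auto
  show False
  proof (cases "large A")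
    case True
    have "card (cut A (V - A) \<inter> G0) \<le> c"
      unfolding c_def using G0 fin by (intro of_nat_mono card_mono) auto
    then have "(1/2 + \<epsilon>) * card (cut A (V - A) \<inter> G0) \<le> (1/2 + \<epsilon>) * c"
      using eps by (intro mult_left_mono) auto
    moreover have "(1 - 2 * \<epsilon>) * e \<le> (1 - 2 * \<epsilon>) * card (all_edges A \<inter> G1)"
      using eps e1 by (intro mult_left_mono) auto
    \<comment> \<open>This is \<open>main\<close> solved for \<open>c\<close>. With \<open>c\<close>
      bounded below through \<open>G0\<close> and \<open>e\<close> above through \<open>G1\<close>,
      it contradicts \<open>expand\<close>.\<close>
    moreover have "(1/2 + \<epsilon>) * c \<le> (1 - 2 * \<epsilon>) * e + (real k - 1) * a"
      using main by (simp add: algebra_simps)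
    ultimately show False using expand[OF AV True A(3)] unfolding a_def by linarith
  next
    case False
    have "e \<le> \<delta> * a * L" using sparse[OF AV A(2) False] e1 by (simp add: a_def)
    have c0: "0 \<le> c" "0 \<le> e" by (auto simp: c_def e_def)
    have "c \<le> 2 * e + 2 * (real k - 1) * a"
    proof -
      have "(1/2 - \<epsilon>) * (2 * e + c) \<le> (1/2) * (2 * e + c)" using eps c0 by (intro mult_right_mono) auto
      then show ?thesis using main by (simp add: algebra_simps)
    qed
    moreover have "2 * (real k - 1) * a \<le> \<delta> * L * a" using L by (intro mult_right_mono) (auto simp: a_def)
    \<comment> \<open>The sum is at most \<open>4 * e + 2 * (real k - 1) * a\<close>: four times
      plus once \<open>\<delta> * L * a\<close>.\<close>
    ultimately have upper: "2 * e + c \<le> 5 * (\<delta> * L * a)"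
      using \<open>e \<le> \<delta> * a * L\<close> by (simp add: algebra_simps)
    define Lo where "Lo = {v\<in>A. degree G v \<le> \<gamma> * L}"
    have LoA: "Lo \<subseteq> A" by (auto simp: Lo_def)
    have deg0: "degree G0 v \<le> degree G v" for v
      unfolding degree_def using G0 fin by (intro card_mono) auto
    have lo0: "degree G0 v \<le> \<gamma> * L" if "v \<in> Lo" for v
      using that deg0[of v] by (simp add: Lo_def)
    \<comment> \<open>Here \<open>2 * k - 2\<close> enters: \<open>v\<close> keeps more than
      \<open>k - 1 \<ge> card S\<close> edges in \<open>G - H\<close>, so one of them ends outside
      \<open>S\<close>. Its end lies in \<open>A\<close>, since edges to the other side are in
      \<open>H\<close>, and \<open>nonadj\<close> keeps it out of \<open>Lo\<close>.\<close>
    have nbr: "\<exists>w\<in>A - Lo. {v, w} \<in> G" if v: "v \<in> Lo" for v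
    proof -
      have vA: "v \<in> A" and vV: "v \<in> V" using v AV by (auto simp: Lo_def)
      have "card {e \<in> G. v \<in> e} = card {e \<in> G - H. v \<in> e} + card {e \<in> H. v \<in> e}"
      proof -
        have split: "{e \<in> G. v \<in> e} = {e \<in> G - H. v \<in> e} \<union> {e \<in> H. v \<in> e}" using H by auto
        show ?thesis unfolding split by (rule card_Un_disjoint) (use fin in auto)
      qed
      then have "real (degree G v) = card {e \<in> G - H. v \<in> e} + degree H v"
        by (simp add: degree_def)
      moreover have "real (degree H v) \<le> (1/2 - \<epsilon>) * real (degree G v)" using H vV by blast
      ultimately have "(1/2 + \<epsilon>) * real (degree G v) \<le> card {e \<in> G - H. v \<in> e}"
        by (simp add: algebra_simps)
      moreover have "real k - 1 < (1/2 + \<epsilon>) * real (degree G v)"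
      proof -
        have "real (2 * k - 2) \<le> real (degree G v)" using mindeg[OF vV] by (rule of_nat_mono)
        then have dg: "2 * (real k - 1) \<le> degree G v" using k by (simp add: of_nat_diff)
        then have "real k - 1 \<le> (1/2) * real (degree G v)" by simp
        \<comment> \<open>Strict because \<open>k \<ge> 2\<close> makes the degree positive.\<close>
        also have "\<dots> < (1/2 + \<epsilon>) * real (degree G v)" using eps k dg by (intro mult_strict_right_mono) auto
        finally show ?thesis .
      qed
      ultimately have "real k - 1 < card {e \<in> G - H. v \<in> e}" by linarith
      then have many: "card S < card {e \<in> G - H. v \<in> e}" using S by linarith
      have "\<not> {e \<in> G - H. v \<in> e} \<subseteq> (\<lambda>s. {v, s}) ` S"
      proof
        assume "{e \<in> G - H. v \<in> e} \<subseteq> (\<lambda>s. {v, s}) ` S"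
        then have "card {e \<in> G - H. v \<in> e} \<le> card S" using S by (meson surj_card_le)
        then show False using many by simp
      qed
      then obtain f where f: "f \<in> G - H" "v \<in> f" "f \<notin> (\<lambda>s. {v, s}) ` S" by auto
      moreover have "card f = 2" "f \<subseteq> V" using f G by (auto simp: all_edges_def)
      ultimately obtain w where w: "f = {v, w}" "w \<noteq> v" "w \<in> V"
        by (auto simp: card_2_iff)
      have "w \<notin> S" using f w by auto
      have "w \<in> A"
      proof (rule ccontr)
        assume "w \<notin> A"
        then have "f \<in> cut A (V - S - A) \<inter> G" using f w vA \<open>w \<notin> S\<close> by (auto simp: cut_def)
        then show False using cutH f by auto
      qed
      moreover have "w \<notin> Lo"
      proof
        assume "w \<in> Lo"
        then have "{v, w} \<notin> G1" using nonadj[OF vV w(3) w(2)[symmetric] lo0[OF v]] lo0 by blast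
        then show False using f(1) w(1) G1 by blast
      qed
      ultimately show ?thesis using f w by auto
    qed
    then obtain h where h: "\<And>v. v \<in> Lo \<Longrightarrow> h v \<in> A - Lo \<and> {v, h v} \<in> G" by metis
    have "inj_on h Lo"
    proof (rule inj_onI, rule ccontr)
      fix u v assume uv: "u \<in> Lo" "v \<in> Lo" "h u = h v" "u \<noteq> v"
      have "u \<in> V" "v \<in> V" using uv AV by (auto simp: Lo_def)
      moreover have "{u, h u} \<in> G1" "{v, h u} \<in> G1"
        using h[OF uv(1)] h[OF uv(2)] uv(3) G1 by auto
      ultimately show False
        using noncommon uv(4) lo0[OF uv(1)] lo0[OF uv(2)] by blast
    qed
    then have "card Lo \<le> card (A - Lo)"
      using fin by (intro card_inj_on_le[of h]) (use h in blast)+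
    moreover have "card A = card Lo + card (A - Lo)"
      using card_Un_disjoint[of Lo "A - Lo"] fin LoA by (simp add: Un_absorb1 finite_subset[OF LoA])
    ultimately have half: "a \<le> 2 * card (A - Lo)" by (simp add: a_def)
    then have "card (A - Lo) > 0" using cardA unfolding a_def by linarith
    then have "A - Lo \<noteq> {}" by (metis card.empty less_irrefl)
    \<comment> \<open>At least half of \<open>A\<close> has degree above
      \<open>\<gamma> * L\<close>, so the degree sum exceeds \<open>\<gamma> * L * a / 2\<close>.
      Against \<open>upper\<close>, this is where \<open>10 * \<delta> \<le> \<gamma>\<close> comes
      from.\<close>
    then have "(\<Sum>v\<in>A - Lo. \<gamma> * L) < (\<Sum>v\<in>A - Lo. real (degree G v))"
      using fin by (intro sum_strict_mono) (auto simp: Lo_def)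
    also have "\<dots> \<le> (\<Sum>v\<in>A. real (degree G v))" using fin by (intro sum_mono2) auto
    also have "\<dots> \<le> 5 * (\<delta> * L * a)" using degG upper by simp
    finally have "card (A - Lo) * (\<gamma> * L) < 5 * (\<delta> * L * a)" by simp
    moreover have "a * (\<gamma> * L) \<le> 2 * card (A - Lo) * (\<gamma> * L)" using half \<gamma> by (intro mult_right_mono) auto
    moreover have "10 * \<delta> * (L * a) \<le> \<gamma> * (L * a)" using \<gamma> by (intro mult_right_mono) (auto simp: a_def)
    ultimately show False by (simp add: algebra_simps)
  qed
qed

subsection \<open>Typical properties of the process\<close>

definition lower_time :: "real \<Rightarrow> nat \<Rightarrow> nat" where
  "lower_time \<eta> n = nat \<lfloor>(1 - \<eta>) * real n * ln (real n) / 2\<rfloor>"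

definition upper_time :: "real \<Rightarrow> nat \<Rightarrow> nat" where
  "upper_time \<eta> n = nat \<lceil>(1 + \<eta>) * real n * ln (real n) / 2\<rceil>"

lemma of_nat_choose_two: "real (n choose 2) = real n * (real n - 1) / 2"
proof -
  have "2 * (n choose 2) = n * (n - 1)"
    by (cases n) (simp_all add: choose_two)
  then have "2 * real (n choose 2) = real n * real (n - 1)"
    by (metis of_nat_mult of_nat_numeral)
  then show ?thesis by (cases n) auto
qed

lemma of_nat_choose_two_le: "real (n choose 2) \<le> (real n)\<^sup>2 / 2"
  by (simp add: of_nat_choose_two power2_eq_square algebra_simps)

lemma lower_time_le: "n \<ge> 1 \<Longrightarrow> \<eta> \<le> 1 \<Longrightarrow> lower_time \<eta> n \<le> (1 - \<eta>) * real n * ln (real n) / 2"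
proof -
  assume "n \<ge> 1" "\<eta> \<le> 1"
  then have "0 \<le> (1 - \<eta>) * real n * ln (real n) / 2" by simp
  then show ?thesis unfolding lower_time_def by linarith
qed

lemma lower_time_ge: "(1 - \<eta>) * real n * ln (real n) / 2 - 1 \<le> lower_time \<eta> n"
  unfolding lower_time_def by linarith

lemma upper_time_ge: "(1 + \<eta>) * real n * ln (real n) / 2 \<le> upper_time \<eta> n"
  unfolding upper_time_def by linarith

lemma upper_time_le: "n \<ge> 1 \<Longrightarrow> 0 \<le> \<eta> \<Longrightarrow> upper_time \<eta> n \<le> (1 + \<eta>) * real n * ln (real n) / 2 + 1"
proof -
  assume "n \<ge> 1" "0 \<le> \<eta>"
  then have "0 \<le> (1 + \<eta>) * real n * ln (real n) / 2" by simp
  then show ?thesis unfolding upper_time_def by linarith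
qed

text \<open>The ratios are those in the tail bounds: time over \<open>n choose 2\<close> for lower
  tails, time over remaining pairs for upper tails. The slack \<open>2 * \<eta>\<close> absorbs
  rounding and lower-order terms; the lower bound at \<open>upper_time\<close> keeps plain
  \<open>\<eta>\<close>, since rounding up and \<open>n - 1 < n\<close> both help.\<close>

lemma eventually_times:
  assumes \<eta>: "0 < \<eta>" "\<eta> < 1"
  shows "eventually (\<lambda>n. lower_time \<eta> n \<le> upper_time \<eta> n \<and> upper_time \<eta> n < n choose 2
     \<and> (1 - 2 * \<eta>) * ln n / n \<le> lower_time \<eta> n / (n choose 2)
     \<and> (1 + \<eta>) * ln n / n \<le> upper_time \<eta> n / (n choose 2)
     \<and> upper_time \<eta> n / (real (n choose 2) - upper_time \<eta> n) \<le> (1 + 2 * \<eta>) * ln n / n) sequentially"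
proof -
  \<comment> \<open>The comparisons are first made for the unrounded real expressions, to which
    asymptotic expansion applies.\<close>
  have "eventually (\<lambda>n. (1 + \<eta>) * real n * ln (real n) / 2 + 1 < real n * (real n - 1) / 2) sequentially"
    using \<eta> by real_asymp
  moreover have "eventually (\<lambda>n. (1 - 2 * \<eta>) * ln n / n
      \<le> ((1 - \<eta>) * real n * ln (real n) / 2 - 1) / (real n * (real n - 1) / 2)) sequentially"
    using \<eta> by real_asymp
  moreover have "eventually (\<lambda>n. (1 + \<eta>) * ln n / n
      \<le> ((1 + \<eta>) * real n * ln (real n) / 2) / (real n * (real n - 1) / 2)) sequentially"
    using \<eta> by real_asymp
  moreover have "eventually (\<lambda>n. ((1 + \<eta>) * real n * ln (real n) / 2 + 1)
        / (real n * (real n - 1) / 2 - ((1 + \<eta>) * real n * ln (real n) / 2 + 1))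
      \<le> (1 + 2 * \<eta>) * ln n / n) sequentially"
    using \<eta> by real_asymp
  ultimately show ?thesis using eventually_ge_at_top[of 2]
  proof eventually_elim
    case (elim n)
    let ?N = "real n * (real n - 1) / 2" and ?lo = "(1 - \<eta>) * real n * ln (real n) / 2"
      and ?up = "(1 + \<eta>) * real n * ln (real n) / 2"
    have n: "n \<ge> 1" "0 < ?N" "0 \<le> ln (real n)" using elim(5) by auto
    have up: "?up \<le> upper_time \<eta> n" "upper_time \<eta> n \<le> ?up + 1"
      using upper_time_ge upper_time_le n \<eta> by auto
    have lo: "?lo - 1 \<le> lower_time \<eta> n" "lower_time \<eta> n \<le> ?lo"
      using lower_time_ge lower_time_le n \<eta> by auto
    have "?lo \<le> ?up" using \<eta> n by (intro divide_right_mono mult_right_mono) auto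
    then have "lower_time \<eta> n \<le> upper_time \<eta> n" using up lo by linarith
    moreover have lt: "real (upper_time \<eta> n) < real (n choose 2)"
      unfolding of_nat_choose_two using elim(1) up by linarith
    moreover have "(1 - 2 * \<eta>) * ln n / n \<le> lower_time \<eta> n / (n choose 2)"
      unfolding of_nat_choose_two by (rule order.trans[OF elim(2) divide_right_mono]) (use lo n in auto)
    moreover have "(1 + \<eta>) * ln n / n \<le> upper_time \<eta> n / (n choose 2)"
      unfolding of_nat_choose_two by (rule order.trans[OF elim(3) divide_right_mono]) (use up n in auto)
    moreover have "upper_time \<eta> n / (real (n choose 2) - upper_time \<eta> n) \<le> (?up + 1) / (?N - (?up + 1))"
      unfolding of_nat_choose_two using up elim(1) n \<eta> by (intro frac_le) auto
    ultimately show ?case using elim(4) by simp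
  qed
qed

section \<open>Union bounds and the edges at a vertex\<close>

lemma prob_tendsto_0:
  assumes "eventually (\<lambda>n. measure_pmf.prob (p n) (A n) \<le> f n) F" "(f \<longlongrightarrow> 0) F"
  shows "((\<lambda>n. measure_pmf.prob (p n) (A n)) \<longlongrightarrow> 0) F"
  by (rule tendsto_sandwich[OF _ assms(1) tendsto_const assms(2)]) simp

lemma prob_Bex_le:
  assumes "finite S"
  shows "measure_pmf.prob p {x. \<exists>s\<in>S. P s x} \<le> (\<Sum>s\<in>S. measure_pmf.prob p {x. P s x})"
proof -
  have "{x. \<exists>s\<in>S. P s x} = (\<Union>s\<in>S. {x. P s x})" by auto
  then show ?thesis using assms by (simp add: measure_pmf.finite_measure_subadditive_finite)
qed

lemma prob_Bex_le_card:
  fixes c :: real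
  assumes "finite S" "\<And>s. s \<in> S \<Longrightarrow> measure_pmf.prob p {x. P s x} \<le> c"
  shows "measure_pmf.prob p {x. \<exists>s\<in>S. P s x} \<le> card S * c"
  using prob_Bex_le[OF assms(1), of p P] sum_bounded_above[of S "\<lambda>s. measure_pmf.prob p {x. P s x}" c] assms(2)
  by (meson order.trans)

text \<open>A fixed set of potential edges: the degree becomes the size of its intersection with the
  graph, which is the form that the tail bounds handle.\<close>

definition star :: "nat \<Rightarrow> nat \<Rightarrow> nat set set" where
  "star n v = {e \<in> all_edges {..<n}. v \<in> e}"

lemma star_eq: "v < n \<Longrightarrow> star n v = (\<lambda>u. {v, u}) ` ({..<n} - {v})"
  by (auto simp: star_def all_edges_def card_2_iff image_iff insert_commute)

lemma star_subset: "star n v \<subseteq> all_edges {..<n}"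
  by (auto simp: star_def)

lemma finite_star: "finite (star n v)"
  by (rule finite_subset[OF star_subset]) (simp add: finite_all_edges)

lemma card_star: "v < n \<Longrightarrow> card (star n v) = n - 1"
  unfolding star_eq by (subst card_image) (auto simp: inj_on_def doubleton_eq_iff)

lemma card_star_Un:
  assumes "u < n" "v < n" "u \<noteq> v"
  shows "card (star n u \<union> star n v) = 2 * n - 3"
proof -
  have "star n u \<inter> star n v = {{u, v}}"
    using assms by (auto simp: star_def all_edges_def card_2_iff)
  then have "card (star n u \<union> star n v) + 1 = (n - 1) + (n - 1)"
    using card_Un_Int[OF finite_star finite_star, of n u n v] assms by (simp add: card_star)
  then show ?thesis using assms by simp
qed

lemma degree_eq_card_star: "G \<subseteq> all_edges {..<n} \<Longrightarrow> degree G v = card (star n v \<inter> G)"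
  unfolding degree_def star_def by (intro arg_cong[where f = card]) auto

section \<open>Vertex degrees at the two times\<close>

text \<open>First moment: \<open>exp (- \<nu>) = \<eta> / 4\<close> brings the exponent of
  \<open>1 / n\<close> for a single vertex to about
  \<open>(1 - \<eta> / 4) * (1 + \<eta>) = 1 + r > 1\<close>, which beats the \<open>n\<close>
  choices. Since \<open>l\<close> is fixed, the price \<open>\<nu> * l\<close> is a
  constant.\<close>

lemma min_degree_bound:
  fixes l :: real
  assumes \<eta>: "0 < \<eta>" "\<eta> < 1"
  shows "(\<lambda>n. measure_pmf.prob (random_graph_process n)
     {Gs. \<exists>v\<in>{..<n}. card (star n v \<inter> Gs ! upper_time \<eta> n) \<le> l}) \<longlonglongrightarrow> 0"
proof -
  define r where "r = (1 - \<eta> / 4) * (1 + \<eta>) - 1"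
  have "r = \<eta> * (3 - \<eta>) / 4" by (simp add: r_def field_simps power2_eq_square)
  moreover have "0 < \<eta> * (3 - \<eta>)" using \<eta> by (intro mult_pos_pos) auto
  ultimately have r: "0 < r" by simp
  define \<nu> where "\<nu> = ln (4 / \<eta>)"
  have \<nu>: "0 \<le> \<nu>" "exp (- \<nu>) = \<eta> / 4" using \<eta> by (auto simp: \<nu>_def exp_minus field_simps)
  define C where "C = \<nu> * l"
  have "eventually (\<lambda>n. measure_pmf.prob (random_graph_process n)
     {Gs. \<exists>v\<in>{..<n}. card (star n v \<inter> Gs ! upper_time \<eta> n) \<le> l}
     \<le> real n * exp (C - (1 + r) * ((real n - 1 - l) * (ln n / n)))) sequentially"
    using eventually_times[OF \<eta>] eventually_ge_at_top[of "nat \<lceil>l + 1\<rceil>"] eventually_ge_at_top[of 1]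
  proof eventually_elim
    case (elim n)
    let ?b = "upper_time \<eta> n"
    have nl: "0 \<le> real n - 1 - l" using elim(2) by linarith
    have "measure_pmf.prob (random_graph_process n) {Gs. card (star n v \<inter> Gs ! ?b) \<le> l}
        \<le> exp (C - (1 + r) * ((real n - 1 - l) * (ln n / n)))" if v: "v \<in> {..<n}" for v
    proof -
      have "measure_pmf.prob (random_graph_process n) {Gs. card (star n v \<inter> Gs ! ?b) \<le> l}
        \<le> exp (\<nu> * l - (1 - exp (-\<nu>)) * (card (star n v) - l) * (?b / (n choose 2)))"
        using elim \<nu> by (intro process_lower_tail star_subset) auto
      then have "measure_pmf.prob (random_graph_process n) {Gs. card (star n v \<inter> Gs ! ?b) \<le> l}
        \<le> exp (C - (1 - \<eta> / 4) * (real n - 1 - l) * (?b / (n choose 2)))"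
        using v \<nu> elim(3) by (simp add: card_star of_nat_diff C_def)
      also have "(1 - \<eta> / 4) * (real n - 1 - l) * ((1 + \<eta>) * ln n / n)
          \<le> (1 - \<eta> / 4) * (real n - 1 - l) * (?b / (n choose 2))"
        using elim nl \<eta> by (intro mult_left_mono) auto
      then have "exp (C - (1 - \<eta> / 4) * (real n - 1 - l) * (?b / (n choose 2)))
          \<le> exp (C - (1 + r) * ((real n - 1 - l) * (ln n / n)))"
        by (simp add: r_def mult_ac)
      finally show ?thesis .
    qed
    then show ?case
      using prob_Bex_le_card[of "{..<n}" "random_graph_process n"
        "\<lambda>v Gs. card (star n v \<inter> Gs ! ?b) \<le> l"] by simp
  qed
  moreover have "(\<lambda>n. real n * exp (C - (1 + r) * ((real n - 1 - l) * (ln n / n)))) \<longlonglongrightarrow> 0"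
    using r by real_asymp
  ultimately show ?thesis by (rule prob_tendsto_0)
qed

text \<open>
  The tail bound is used with \<open>exp \<mu> = n / ln n\<close> and \<open>exp (-\<nu>) = 1/4\<close>.  The constant is
  \<open>45/64 = (1 - 1/4) * 15/16\<close> with \<open>15/16 \<le> 1 - 2 * \<eta>\<close>; as \<open>2 * 45/64 > 1 + 4/100\<close>, the bound beats the
  at most \<open>n ^ (card I + 1)\<close> configurations of \<open>u\<close>, \<open>v\<close>, \<open>I\<close> in question.
\<close>

lemma low_degree_pair_bound:
  assumes \<eta>: "0 < \<eta>" "\<eta> \<le> 1/32"
  shows "eventually (\<lambda>n. \<forall>u<n. \<forall>v<n. \<forall>I. u \<noteq> v \<longrightarrow> I \<subseteq> all_edges {..<n} \<longrightarrow> card I \<le> 2 \<longrightarrow>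
    measure_pmf.prob (random_graph_process n) {Gs. I \<subseteq> Gs ! upper_time \<eta> n
      \<and> card (star n u \<inter> Gs ! lower_time \<eta> n) \<le> 1/100 * ln (real n)
      \<and> card (star n v \<inter> Gs ! lower_time \<eta> n) \<le> 1/100 * ln (real n)}
    \<le> (ln n / n) ^ card I * exp (4 + 4/100 * ln (real n)
         - 45/64 * (2 * real n - 5 - 2/100 * ln (real n)) * (ln n / n))) sequentially"
proof -
  have "\<eta> < 1" using \<eta> by simp
  have "eventually (\<lambda>n. ln (real n) \<le> real n) sequentially" by real_asymp
  moreover have "eventually (\<lambda>n. 1 \<le> ln (real n)) sequentially" by real_asymp
  ultimately show ?thesis using eventually_times[OF \<eta>(1) \<open>\<eta> < 1\<close>] eventually_ge_at_top[of 5]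
  proof eventually_elim
    case (elim n)
    let ?a = "lower_time \<eta> n" and ?b = "upper_time \<eta> n" and ?L = "ln (real n)"
    show ?case
    proof (intro allI impI)
      fix u v I
      assume uv: "u < n" "v < n" "u \<noteq> v" and I: "I \<subseteq> all_edges {..<n}" "card I \<le> 2"
      have finI: "finite I" using I(1) by (rule finite_subset) (simp add: finite_all_edges)
      \<comment> \<open>Removing \<open>I\<close> makes the two sets disjoint; this costs at most
        two of the \<open>2 * n - 3\<close> edges, hence the 5 below.\<close>
      define F where "F = (star n u \<union> star n v) - I"
      define l where "l = 2/100 * ?L"
      have F: "F \<subseteq> all_edges {..<n}" "I \<inter> F = {}" by (auto simp: F_def star_def)
      have "card (star n u \<union> star n v) - card I \<le> card F"
        unfolding F_def by (rule diff_card_le_card_Diff[OF finI])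
      then have cF: "2 * real n - 5 \<le> card F" using card_star_Un[OF uv] I elim(4) by linarith
      define \<mu> where "\<mu> = ln (real n / ?L)"
      have n: "0 < real n" "0 < ?L" using elim by auto
      have \<mu>: "0 \<le> \<mu>" "exp \<mu> = n / ?L" using elim n by (auto simp: \<mu>_def)
      have "ln (4::real) = 2 * ln 2" using ln_realpow[of "2::real" 2] by simp
      then have ln4: "0 \<le> ln (4::real)" "ln (4::real) \<le> 2"
        using ln_2_less_1 by auto
      have e4: "exp (- ln 4) = (1/4::real)" by (simp add: exp_minus)
      \<comment> \<open>The two degree conditions merge into one for \<open>F\<close>, with twice
        the threshold.\<close>
      have sub: "{Gs. I \<subseteq> Gs ! ?b \<and> card (star n u \<inter> Gs ! ?a) \<le> 1/100 * ?L \<and> card (star n v \<inter> Gs ! ?a) \<le> 1/100 * ?L}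
        \<subseteq> {Gs. real (card I) \<le> card (I \<inter> Gs ! ?b) \<and> card (F \<inter> Gs ! ?a) \<le> l}"
      proof safe
        fix Gs assume "I \<subseteq> Gs ! ?b"
        then show "real (card I) \<le> card (I \<inter> Gs ! ?b)" by (simp add: Int_absorb2)
      next
        fix Gs assume *: "card (star n u \<inter> Gs ! ?a) \<le> 1/100 * ?L" "card (star n v \<inter> Gs ! ?a) \<le> 1/100 * ?L"
        have "card (F \<inter> Gs ! ?a) \<le> card ((star n u \<inter> Gs ! ?a) \<union> (star n v \<inter> Gs ! ?a))"
          by (rule card_mono) (auto simp: F_def finite_star)
        also have "\<dots> \<le> card (star n u \<inter> Gs ! ?a) + card (star n v \<inter> Gs ! ?a)" by (rule card_Un_le)
        finally show "card (F \<inter> Gs ! ?a) \<le> l" using * unfolding l_def by linarith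
      qed
      have "measure_pmf.prob (random_graph_process n)
         {Gs. I \<subseteq> Gs ! ?b \<and> card (star n u \<inter> Gs ! ?a) \<le> 1/100 * ?L \<and> card (star n v \<inter> Gs ! ?a) \<le> 1/100 * ?L}
        \<le> measure_pmf.prob (random_graph_process n) {Gs. real (card I) \<le> card (I \<inter> Gs ! ?b) \<and> card (F \<inter> Gs ! ?a) \<le> l}"
        by (rule measure_pmf.finite_measure_mono[OF sub]) simp
      also have "\<dots> \<le> exp (- \<mu> * card I + (exp \<mu> - 1) * card I * (?b / (real (n choose 2) - ?b))
          + ln 4 * l - (1 - exp (-ln 4)) * (card F - l) * (?a / (n choose 2)))"
        using elim \<mu> F I ln4 by (intro process_tail) auto
      also have "\<dots> \<le> exp (- \<mu> * card I + 4 + 4/100 * ?L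
          - 45/64 * (2 * real n - 5 - 2/100 * ?L) * (?L / n))"
      proof -
        \<comment> \<open>The choice \<open>exp \<mu> = n / ?L\<close> is balanced against a density
          of order \<open>?L / n\<close>: this term stays bounded, while
          \<open>exp (- \<mu> * card I)\<close> supplies a factor \<open>?L / n\<close> per edge of
          \<open>I\<close>.\<close>
        have "(exp \<mu> - 1) * card I * (?b / (real (n choose 2) - ?b)) \<le> (n / ?L) * 2 * (2 * ?L / n)"
        proof (intro mult_mono)
          show "?b / (real (n choose 2) - ?b) \<le> 2 * ?L / n"
            by (rule order.trans[of _ "(1 + 2 * \<eta>) * ?L / n"])
              (use elim \<eta> n in \<open>auto intro!: divide_right_mono mult_right_mono\<close>)
        qed (use \<mu> I n elim in auto)
        also have "\<dots> = 4" using n by simp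
        finally have 1: "(exp \<mu> - 1) * card I * (?b / (real (n choose 2) - ?b)) \<le> 4" .
        have "ln 4 * l \<le> 2 * l" using ln4 n by (intro mult_right_mono) (auto simp: l_def)
        then have 2: "ln 4 * l \<le> 4/100 * ?L" by (simp add: l_def)
        have nl: "0 \<le> 2 * real n - 5 - 2/100 * ?L" using elim by simp
        have "45/64 * (2 * real n - 5 - 2/100 * ?L) * (?L / n)
          = (3/4) * (2 * real n - 5 - 2/100 * ?L) * ((15/16) * ?L / n)" by simp
        also have "\<dots> \<le> (3/4) * (2 * real n - 5 - 2/100 * ?L) * ((1 - 2 * \<eta>) * ?L / n)"
          using nl \<eta> n by (intro mult_left_mono divide_right_mono mult_right_mono) auto
        also have "\<dots> \<le> (1 - exp (-ln 4)) * (card F - l) * (?a / (n choose 2))"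
          using elim nl cF \<eta> n e4 unfolding l_def by (intro mult_mono mult_nonneg_nonneg) auto
        finally have 3: "45/64 * (2 * real n - 5 - 2/100 * ?L) * (?L / n)
          \<le> (1 - exp (-ln 4)) * (card F - l) * (?a / (n choose 2))" .
        show ?thesis unfolding exp_le_cancel_iff using 1 2 3 by linarith
      qed
      also have "\<dots> = exp (- \<mu>) ^ card I * exp (4 + 4/100 * ?L - 45/64 * (2 * real n - 5 - 2/100 * ?L) * (?L / n))"
        by (simp add: exp_of_nat_mult[symmetric] exp_add[symmetric] mult_ac)
      also have "exp (- \<mu>) = ?L / n" using \<mu> by (simp add: exp_minus)
      finally show "measure_pmf.prob (random_graph_process n)
         {Gs. I \<subseteq> Gs ! ?b \<and> card (star n u \<inter> Gs ! ?a) \<le> 1/100 * ?L \<and> card (star n v \<inter> Gs ! ?a) \<le> 1/100 * ?L}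
         \<le> (?L / n) ^ card I * exp (4 + 4/100 * ?L - 45/64 * (2 * real n - 5 - 2/100 * ?L) * (?L / n))" .
    qed
  qed
qed

text \<open>A union bound over at most \<open>n ^ 2\<close> pairs with the single edge
  \<open>I = {{u, v}}\<close>; the total is about \<open>n\<close> to the power
  \<open>1 + 4/100 - 45/32\<close>, up to logarithms.\<close>

lemma low_degree_nonadjacent:
  assumes \<eta>: "0 < \<eta>" "\<eta> \<le> 1/32"
  shows "(\<lambda>n. measure_pmf.prob (random_graph_process n)
     {Gs. \<exists>(u, v)\<in>{(u, v). u < n \<and> v < n \<and> u \<noteq> v}. {u, v} \<in> Gs ! upper_time \<eta> n
      \<and> card (star n u \<inter> Gs ! lower_time \<eta> n) \<le> 1/100 * ln (real n)
      \<and> card (star n v \<inter> Gs ! lower_time \<eta> n) \<le> 1/100 * ln (real n)}) \<longlonglongrightarrow> 0"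
proof -
  define f where "f = (\<lambda>n::nat. exp (4 + 4/100 * ln (real n)
         - 45/64 * (2 * real n - 5 - 2/100 * ln (real n)) * (ln n / n)))"
  have "eventually (\<lambda>n. measure_pmf.prob (random_graph_process n)
     {Gs. \<exists>(u, v)\<in>{(u, v). u < n \<and> v < n \<and> u \<noteq> v}. {u, v} \<in> Gs ! upper_time \<eta> n
      \<and> card (star n u \<inter> Gs ! lower_time \<eta> n) \<le> 1/100 * ln (real n)
      \<and> card (star n v \<inter> Gs ! lower_time \<eta> n) \<le> 1/100 * ln (real n)}
     \<le> real n ^ 2 * (ln n / n * f n)) sequentially"
    using low_degree_pair_bound[OF \<eta>] eventually_ge_at_top[of 1]
  proof eventually_elim
    case (elim n)
    let ?S = "{(u, v). u < n \<and> v < n \<and> u \<noteq> v}"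
    have S: "?S \<subseteq> {..<n} \<times> {..<n}" by auto
    then have finS: "finite ?S" by (rule finite_subset) simp
    have "card ?S \<le> card ({..<n} \<times> {..<n})" using S by (rule card_mono[rotated]) simp
    then have cS: "card ?S \<le> n ^ 2" by (simp add: card_cartesian_product power2_eq_square)
    have "measure_pmf.prob (random_graph_process n) {Gs. \<exists>s\<in>?S. case s of (u, v) \<Rightarrow> {u, v} \<in> Gs ! upper_time \<eta> n
      \<and> card (star n u \<inter> Gs ! lower_time \<eta> n) \<le> 1/100 * ln (real n)
      \<and> card (star n v \<inter> Gs ! lower_time \<eta> n) \<le> 1/100 * ln (real n)} \<le> card ?S * (ln n / n * f n)"
    proof (rule prob_Bex_le_card[OF finS])
      fix s assume "s \<in> ?S"
      then obtain u v where s: "s = (u, v)" and uv: "u < n" "v < n" "u \<noteq> v" by auto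
      have "{{u, v}} \<subseteq> all_edges {..<n}" "card {{u, v}} = 1" using uv by (auto simp: all_edges_def)
      then have "measure_pmf.prob (random_graph_process n) {Gs. {{u, v}} \<subseteq> Gs ! upper_time \<eta> n
      \<and> card (star n u \<inter> Gs ! lower_time \<eta> n) \<le> 1/100 * ln (real n)
      \<and> card (star n v \<inter> Gs ! lower_time \<eta> n) \<le> 1/100 * ln (real n)} \<le> (ln n / n) ^ card {{u, v}} * f n"
        unfolding f_def by (intro elim(1)[rule_format] uv) auto
      then show "measure_pmf.prob (random_graph_process n) {Gs. case s of (u, v) \<Rightarrow> {u, v} \<in> Gs ! upper_time \<eta> n
      \<and> card (star n u \<inter> Gs ! lower_time \<eta> n) \<le> 1/100 * ln (real n)
      \<and> card (star n v \<inter> Gs ! lower_time \<eta> n) \<le> 1/100 * ln (real n)} \<le> ln n / n * f n" by (simp add: s)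
    qed
    also have "\<dots> \<le> real n ^ 2 * (ln n / n * f n)"
      using cS elim(2) by (intro mult_right_mono) (auto simp: f_def simp flip: of_nat_power)
    finally show ?case .
  qed
  moreover have "(\<lambda>n. real n ^ 2 * (ln n / n * f n)) \<longlonglongrightarrow> 0" unfolding f_def by real_asymp
  ultimately show ?thesis by (rule prob_tendsto_0)
qed

text \<open>One more vertex costs a factor \<open>n\<close> and one more edge gains
  \<open>ln n / n\<close>, so only a logarithm is lost against the adjacent case.\<close>

lemma low_degree_no_common_neighbour:
  assumes \<eta>: "0 < \<eta>" "\<eta> \<le> 1/32"
  shows "(\<lambda>n. measure_pmf.prob (random_graph_process n)
     {Gs. \<exists>(u, v, w)\<in>{(u, v, w). u < n \<and> v < n \<and> w < n \<and> u \<noteq> v \<and> u \<noteq> w \<and> v \<noteq> w}.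
       {u, w} \<in> Gs ! upper_time \<eta> n \<and> {v, w} \<in> Gs ! upper_time \<eta> n
      \<and> card (star n u \<inter> Gs ! lower_time \<eta> n) \<le> 1/100 * ln (real n)
      \<and> card (star n v \<inter> Gs ! lower_time \<eta> n) \<le> 1/100 * ln (real n)}) \<longlonglongrightarrow> 0"
proof -
  define f where "f = (\<lambda>n::nat. exp (4 + 4/100 * ln (real n)
         - 45/64 * (2 * real n - 5 - 2/100 * ln (real n)) * (ln n / n)))"
  have "eventually (\<lambda>n. measure_pmf.prob (random_graph_process n)
     {Gs. \<exists>(u, v, w)\<in>{(u, v, w). u < n \<and> v < n \<and> w < n \<and> u \<noteq> v \<and> u \<noteq> w \<and> v \<noteq> w}.
       {u, w} \<in> Gs ! upper_time \<eta> n \<and> {v, w} \<in> Gs ! upper_time \<eta> n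
      \<and> card (star n u \<inter> Gs ! lower_time \<eta> n) \<le> 1/100 * ln (real n)
      \<and> card (star n v \<inter> Gs ! lower_time \<eta> n) \<le> 1/100 * ln (real n)}
     \<le> real n ^ 3 * ((ln n / n)\<^sup>2 * f n)) sequentially"
    using low_degree_pair_bound[OF \<eta>] eventually_ge_at_top[of 1]
  proof eventually_elim
    case (elim n)
    let ?S = "{(u, v, w). u < n \<and> v < n \<and> w < n \<and> u \<noteq> v \<and> u \<noteq> w \<and> v \<noteq> w}"
    have S: "?S \<subseteq> {..<n} \<times> {..<n} \<times> {..<n}" by auto
    then have finS: "finite ?S" by (rule finite_subset) simp
    have "card ?S \<le> card ({..<n} \<times> {..<n} \<times> {..<n})" using S by (rule card_mono[rotated]) simp
    then have cS: "card ?S \<le> n ^ 3" by (simp add: card_cartesian_product power3_eq_cube mult_ac)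
    have "measure_pmf.prob (random_graph_process n) {Gs. \<exists>s\<in>?S. case s of (u, v, w) \<Rightarrow>
      {u, w} \<in> Gs ! upper_time \<eta> n \<and> {v, w} \<in> Gs ! upper_time \<eta> n
      \<and> card (star n u \<inter> Gs ! lower_time \<eta> n) \<le> 1/100 * ln (real n)
      \<and> card (star n v \<inter> Gs ! lower_time \<eta> n) \<le> 1/100 * ln (real n)} \<le> card ?S * ((ln n / n)\<^sup>2 * f n)"
    proof (rule prob_Bex_le_card[OF finS])
      fix s assume "s \<in> ?S"
      then obtain u v w where s: "s = (u, v, w)" and uvw: "u < n" "v < n" "w < n" "u \<noteq> v" "u \<noteq> w" "v \<noteq> w" by auto
      have "{{u, w}, {v, w}} \<subseteq> all_edges {..<n}" "card {{u, w}, {v, w}} = 2"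
        using uvw by (auto simp: all_edges_def doubleton_eq_iff)
      then have "measure_pmf.prob (random_graph_process n) {Gs. {{u, w}, {v, w}} \<subseteq> Gs ! upper_time \<eta> n
      \<and> card (star n u \<inter> Gs ! lower_time \<eta> n) \<le> 1/100 * ln (real n)
      \<and> card (star n v \<inter> Gs ! lower_time \<eta> n) \<le> 1/100 * ln (real n)} \<le> (ln n / n) ^ card {{u, w}, {v, w}} * f n"
        unfolding f_def by (intro elim(1)[rule_format] uvw) auto
      then show "measure_pmf.prob (random_graph_process n) {Gs. case s of (u, v, w) \<Rightarrow>
        {u, w} \<in> Gs ! upper_time \<eta> n \<and> {v, w} \<in> Gs ! upper_time \<eta> n
      \<and> card (star n u \<inter> Gs ! lower_time \<eta> n) \<le> 1/100 * ln (real n)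
      \<and> card (star n v \<inter> Gs ! lower_time \<eta> n) \<le> 1/100 * ln (real n)} \<le> (ln n / n)\<^sup>2 * f n"
        using \<open>card {{u, w}, {v, w}} = 2\<close> by (simp add: s)
    qed
    also have "\<dots> \<le> real n ^ 3 * ((ln n / n)\<^sup>2 * f n)"
      using cS elim(2) by (intro mult_right_mono) (auto simp: f_def simp flip: of_nat_power)
    finally show ?case .
  qed
  moreover have "(\<lambda>n. real n ^ 3 * ((ln n / n)\<^sup>2 * f n)) \<longlonglongrightarrow> 0" unfolding f_def by real_asymp
  ultimately show ?thesis by (rule prob_tendsto_0)
qed

section \<open>Edges inside and across vertex sets\<close>

lemma card_all_edges_le:
  assumes "finite A"
  shows "real (card (all_edges A)) \<le> (real (card A))\<^sup>2 / 2"
  using of_nat_choose_two_le by (simp add: card_all_edges assms)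

lemma sum_Pow_power_card:
  fixes x :: real
  assumes "finite V"
  shows "(\<Sum>A\<in>Pow V. x ^ card A) = (1 + x) ^ card V"
  using prod_add[OF assms, of "\<lambda>_. x" "\<lambda>_. 1"] by (simp add: add.commute)

text \<open>
  For a set of \<open>a\<close> vertices the tail bound is \<open>n powr (- 3 * a)\<close>, and these bounds sum to
  \<open>(1 + n powr (- 3)) ^ n - 1\<close> over all nonempty sets.
\<close>

lemma small_sets_sparse:
  assumes \<eta>: "0 < \<eta>" "\<eta> \<le> 1/2" and \<delta>: "0 < \<delta>"
  shows "(\<lambda>n. measure_pmf.prob (random_graph_process n)
     {Gs. \<exists>A\<in>{A. A \<subseteq> {..<n} \<and> A \<noteq> {} \<and> real (card A) \<le> exp (- 4 / \<delta>) * real n}.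
        \<delta> * card A * ln (real n) \<le> card (all_edges A \<inter> Gs ! upper_time \<eta> n)}) \<longlonglongrightarrow> 0"
proof -
  have \<eta>1: "\<eta> < 1" using \<eta> by simp
  \<comment> \<open>Turns the deviation term into \<open>- 4 * card A * ln n\<close>; the size limit
    is \<open>exp (- \<mu>) * n\<close>, which bounds the other term by
    \<open>card A * ln n\<close>.\<close>
  define \<mu> where "\<mu> = 4 / \<delta>"
  have \<mu>: "0 < \<mu>" "\<mu> * \<delta> = 4" using \<delta> by (auto simp: \<mu>_def)
  have "eventually (\<lambda>n. 1 \<le> ln (real n)) sequentially" by real_asymp
  then have "eventually (\<lambda>n. measure_pmf.prob (random_graph_process n)
     {Gs. \<exists>A\<in>{A. A \<subseteq> {..<n} \<and> A \<noteq> {} \<and> real (card A) \<le> exp (- 4 / \<delta>) * real n}.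
        \<delta> * card A * ln (real n) \<le> card (all_edges A \<inter> Gs ! upper_time \<eta> n)}
     \<le> exp (real n * exp (- 3 * ln (real n))) - 1) sequentially"
    using eventually_times[OF \<eta>(1) \<eta>1] eventually_ge_at_top[of 2]
  proof eventually_elim
    case (elim n)
    let ?b = "upper_time \<eta> n" and ?L = "ln (real n)"
    let ?S = "{A. A \<subseteq> {..<n} \<and> A \<noteq> {} \<and> real (card A) \<le> exp (- 4 / \<delta>) * real n}"
    have n: "0 < real n" "0 < ?L" using elim by auto
    have finS: "finite ?S" by (rule finite_subset[of _ "Pow {..<n}"]) auto
    have one: "measure_pmf.prob (random_graph_process n)
        {Gs. \<delta> * card A * ?L \<le> card (all_edges A \<inter> Gs ! ?b)} \<le> exp (- 3 * ?L) ^ card A"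
      if A: "A \<in> ?S" for A
    proof -
      have finA: "finite A" using A finite_subset by auto
      have a: "real (card A) \<le> exp (- \<mu>) * n" using A by (simp add: \<mu>_def)
      have "measure_pmf.prob (random_graph_process n) {Gs. \<delta> * card A * ?L \<le> card (all_edges A \<inter> Gs ! ?b)}
        \<le> exp (- \<mu> * (\<delta> * card A * ?L) + (exp \<mu> - 1) * card (all_edges A) * (?b / (real (n choose 2) - ?b)))"
        using elim \<mu> A by (intro process_upper_tail all_edges_mono) auto
      also have "\<dots> = exp (- 4 * card A * ?L + (exp \<mu> - 1) * card (all_edges A) * (?b / (real (n choose 2) - ?b)))"
        using \<mu>(2) by (simp add: mult.assoc[symmetric])
      also have "\<dots> \<le> exp (- 4 * card A * ?L + card A * ?L)"
      proof -
        have "(exp \<mu> - 1) * card (all_edges A) * (?b / (real (n choose 2) - ?b))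
          \<le> exp \<mu> * ((real (card A))\<^sup>2 / 2) * (2 * ?L / n)"
        proof (intro mult_mono)
          show "?b / (real (n choose 2) - ?b) \<le> 2 * ?L / n"
            by (rule order.trans[of _ "(1 + 2 * \<eta>) * ?L / n"])
              (use elim \<eta> n in \<open>auto intro!: divide_right_mono mult_right_mono\<close>)
        qed (use \<mu> n elim card_all_edges_le[OF finA] in auto)
        also have "\<dots> = (exp \<mu> * card A / n) * (card A * ?L)"
          by (simp add: power2_eq_square)
        also have "\<dots> \<le> 1 * (card A * ?L)"
        proof (intro mult_right_mono)
          show "exp \<mu> * card A / n \<le> 1"
            using mult_left_mono[OF a, of "exp \<mu>"] n by (simp add: exp_minus field_simps)
        qed (use n in auto)
        finally show ?thesis by simp
      qed
      also have "- 4 * card A * ?L + card A * ?L = card A * (- 3 * ?L)" by simp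
      also have "exp \<dots> = exp (- 3 * ?L) ^ card A" by (rule exp_of_nat_mult)
      finally show ?thesis by simp
    qed
    have "measure_pmf.prob (random_graph_process n)
        {Gs. \<exists>A\<in>?S. \<delta> * card A * ?L \<le> card (all_edges A \<inter> Gs ! ?b)} \<le> (\<Sum>A\<in>?S. exp (- 3 * ?L) ^ card A)"
      by (rule order.trans[OF prob_Bex_le[OF finS] sum_mono[OF one]])
    also have "\<dots> \<le> (\<Sum>A\<in>Pow {..<n} - {{}}. exp (- 3 * ?L) ^ card A)"
      by (rule sum_mono2) auto
    also have "\<dots> = (\<Sum>A\<in>Pow {..<n}. exp (- 3 * ?L) ^ card A) - 1"
      by (subst sum_diff) auto
    also have "\<dots> = (1 + exp (- 3 * ?L)) ^ n - 1"
      by (simp add: sum_Pow_power_card)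
    also have "\<dots> \<le> exp (exp (- 3 * ?L)) ^ n - 1"
      by (intro diff_right_mono power_mono) (auto simp: exp_ge_add_one_self add_nonneg_nonneg)
    finally show ?case by (simp add: exp_of_nat_mult)
  qed
  moreover have "(\<lambda>n. exp (real n * exp (- 3 * ln (real n))) - 1) \<longlonglongrightarrow> 0" by real_asymp
  ultimately show ?thesis by (rule prob_tendsto_0)
qed

text \<open>Keeps the relative loss in the lower tail at a factor \<open>1 - \<nu>\<close>.\<close>

lemma one_minus_exp_ge:
  fixes x :: real
  assumes "0 \<le> x"
  shows "x * (1 - x) \<le> 1 - exp (- x)"
proof -
  have "exp (- x) \<le> 1 / (1 + x)"
    using exp_ge_add_one_self[of x] assms by (simp add: exp_minus field_simps)
  also have "\<dots> \<le> 1 - x + x\<^sup>2" using assms by (simp add: field_simps power2_eq_square)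
  finally show ?thesis by (simp add: power2_eq_square algebra_simps)
qed

text \<open>A union bound over all \<open>2 ^ n\<close> subsets suffices, because the exponent is of
  order \<open>n * ln n\<close>.\<close>

lemma prob_subsets_tendsto_0:
  assumes c: "0 < c" and "eventually (\<lambda>n. \<forall>A. A \<subseteq> {..<n} \<and> Q n A \<longrightarrow>
     measure_pmf.prob (p n) {Gs. P n A Gs} \<le> exp (- c * (n * ln n))) sequentially"
  shows "(\<lambda>n. measure_pmf.prob (p n) {Gs. \<exists>A\<in>{A. A \<subseteq> {..<n} \<and> Q n A}. P n A Gs}) \<longlonglongrightarrow> 0"
proof (rule prob_tendsto_0)
  show "eventually (\<lambda>n. measure_pmf.prob (p n) {Gs. \<exists>A\<in>{A. A \<subseteq> {..<n} \<and> Q n A}. P n A Gs}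
      \<le> 2 ^ n * exp (- c * (n * ln n))) sequentially"
    using assms(2)
  proof eventually_elim
    case (elim n)
    let ?S = "{A. A \<subseteq> {..<n} \<and> Q n A}"
    have S: "?S \<subseteq> Pow {..<n}" by auto
    then have finS: "finite ?S" by (rule finite_subset) simp
    have "measure_pmf.prob (p n) {Gs. \<exists>A\<in>?S. P n A Gs} \<le> card ?S * exp (- c * (n * ln n))"
      using elim by (intro prob_Bex_le_card finS) auto
    also have "card ?S \<le> card (Pow {..<n})" using S by (rule card_mono[rotated]) simp
    then have "card ?S * exp (- c * (n * ln n)) \<le> 2 ^ n * exp (- c * (n * ln n))"
      by (intro mult_right_mono) (simp_all add: card_Pow flip: of_nat_le_iff)
    finally show ?case .
  qed
  show "(\<lambda>n. 2 ^ n * exp (- c * (n * ln n))) \<longlonglongrightarrow> 0" using c by real_asymp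
qed

text \<open>Chernoff bound with \<open>\<nu> = \<theta> / 4\<close>: there are at least
  \<open>\<kappa> * n * n / 2\<close> pairs across, so a relative deviation costs an exponent of
  order \<open>n * ln n\<close>. The time parameter \<open>\<theta> / 8\<close> makes the density
  loss \<open>2 * (\<theta> / 8)\<close> equal to \<open>\<nu>\<close>.\<close>

lemma large_sets_cut:
  assumes \<theta>: "0 < \<theta>" "\<theta> \<le> 1" and \<kappa>: "0 < \<kappa>"
  shows "(\<lambda>n. measure_pmf.prob (random_graph_process n)
     {Gs. \<exists>A\<in>{A. A \<subseteq> {..<n} \<and> \<kappa> * real n \<le> card A \<and> 2 * card A \<le> n}.
        card (cut A ({..<n} - A) \<inter> Gs ! lower_time (\<theta> / 8) n)
          \<le> (1 - \<theta>) * (card A * (real n - card A)) * (ln n / n)}) \<longlonglongrightarrow> 0"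
proof (rule prob_subsets_tendsto_0)
  show "0 < \<theta>\<^sup>2 / 32 * \<kappa>" using assms by simp
  \<comment> \<open>Ensures \<open>l \<le> \<nu> * s\<close> below.\<close>
  have "eventually (\<lambda>n. ln (real n) / n \<le> \<theta> / 4) sequentially" using \<theta> by real_asymp
  moreover have "eventually (\<lambda>n. 1 \<le> ln (real n)) sequentially" by real_asymp
  moreover have "0 < \<theta> / 8" "\<theta> / 8 < 1" using \<theta> by auto
  note eventually_times[OF this]
  ultimately show "eventually (\<lambda>n. \<forall>A. A \<subseteq> {..<n} \<and> (\<kappa> * real n \<le> card A \<and> 2 * card A \<le> n) \<longrightarrow>
     measure_pmf.prob (random_graph_process n) {Gs. card (cut A ({..<n} - A) \<inter> Gs ! lower_time (\<theta> / 8) n)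
          \<le> (1 - \<theta>) * (card A * (real n - card A)) * (ln n / n)} \<le> exp (- (\<theta>\<^sup>2 / 32 * \<kappa>) * (n * ln n))) sequentially"
    using eventually_ge_at_top[of 2]
  proof eventually_elim
    case (elim n)
    let ?a = "lower_time (\<theta> / 8) n" and ?L = "ln (real n)"
    have n: "0 < real n" "0 < ?L" using elim by auto
    show ?case
    proof (intro allI impI)
      fix A assume A: "A \<subseteq> {..<n} \<and> (\<kappa> * real n \<le> card A \<and> 2 * card A \<le> n)"
      then have finA: "finite A" using finite_subset by auto
      define F where "F = cut A ({..<n} - A)"
      have F: "F \<subseteq> all_edges {..<n}" using A unfolding F_def by (intro cut_subset_all_edges) auto
      define s where "s = real (card F)"
      define l where "l = (1 - \<theta>) * s * (?L / n)"
      have "card F = card A * (n - card A)"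
        using A finA unfolding F_def by (subst card_cut) (auto simp: card_Diff_subset)
      then have s: "s = card A * (real n - card A)" using A by (simp add: s_def of_nat_diff)
      have s_ge: "\<kappa> * n * (n / 2) \<le> s" unfolding s using A \<kappa> by (intro mult_mono) auto
      have s0: "0 \<le> s" by (simp add: s_def)
      define \<nu> where "\<nu> = \<theta> / 4"
      have \<nu>: "0 \<le> \<nu>" "\<nu> \<le> 1/4" using \<theta> by (auto simp: \<nu>_def)
      have \<theta>\<nu>: "\<theta> = 4 * \<nu>" by (simp add: \<nu>_def)
      have "measure_pmf.prob (random_graph_process n) {Gs. card (F \<inter> Gs ! ?a) \<le> l}
        \<le> exp (\<nu> * l - (1 - exp (- \<nu>)) * (s - l) * (?a / (n choose 2)))"
        unfolding s_def using elim \<nu> F by (intro process_lower_tail) auto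
      also have "\<dots> \<le> exp (- (\<theta>\<^sup>2 / 32 * \<kappa>) * (n * ?L))"
      proof -
        have sl: "s * (1 - \<nu>) \<le> s - l"
        proof -
          have "l \<le> 1 * s * (\<theta> / 4)" unfolding l_def using \<theta> s0 elim n by (intro mult_mono) auto
          then show ?thesis by (simp add: \<nu>_def algebra_simps)
        qed
        \<comment> \<open>Three factors \<open>1 - \<nu>\<close> are lost: from
          \<open>1 - exp (- \<nu>)\<close>, from \<open>s - l\<close> and from the density. The
          threshold has \<open>1 - \<theta> = 1 - 4 * \<nu>\<close>, which is below
          \<open>(1 - \<nu>) ^ 3\<close> by at least \<open>\<nu>\<close>.\<close>
        have "\<nu> * (1 - \<nu>) * (s * (1 - \<nu>)) * ((1 - \<nu>) * (?L / n)) \<le> (1 - exp (- \<nu>)) * (s - l) * (?a / (n choose 2))"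
        proof (intro mult_mono one_minus_exp_ge sl)
          show "(1 - \<nu>) * (?L / n) \<le> ?a / (n choose 2)" using elim by (simp add: \<nu>_def)
          have "0 \<le> s - l" by (rule order.trans[OF _ sl]) (use s0 \<nu> in auto)
          then show "0 \<le> (1 - exp (- \<nu>)) * (s - l)" using \<nu> by (intro mult_nonneg_nonneg) auto
        qed (use \<nu> s0 n in auto)
        moreover have "\<nu> * ((1 - \<theta>) * s * y) - \<nu> * (1 - \<nu>) * (s * (1 - \<nu>)) * ((1 - \<nu>) * y)
            = \<nu> * s * y * ((1 - \<theta>) - (1 - \<nu>) ^ 3)" for y
          by (simp add: power3_eq_cube algebra_simps)
        note this[of "?L / n", folded l_def]
        moreover have "\<nu> * s * (?L / n) * ((1 - \<theta>) - (1 - \<nu>) ^ 3) \<le> \<nu> * s * (?L / n) * (- \<nu>)"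
        proof (intro mult_left_mono)
          have "(1 - \<theta>) - (1 - \<nu>) ^ 3 = - \<nu> - \<nu>\<^sup>2 * (3 - \<nu>)"
            using \<theta>\<nu> by (simp add: power3_eq_cube power2_eq_square algebra_simps)
          then show "(1 - \<theta>) - (1 - \<nu>) ^ 3 \<le> - \<nu>" using \<nu> by simp
        qed (use \<nu> s0 n in auto)
        moreover have "(\<kappa> * n * (n / 2)) * (\<nu>\<^sup>2 * (?L / n)) \<le> s * (\<nu>\<^sup>2 * (?L / n))"
          using n by (intro mult_right_mono s_ge) auto
        moreover have "(\<kappa> * n * (n / 2)) * (\<nu>\<^sup>2 * (?L / n)) = \<theta>\<^sup>2 / 32 * \<kappa> * (n * ?L)"
          using n by (simp add: \<nu>_def power2_eq_square)
        moreover have "s * (\<nu>\<^sup>2 * (?L / n)) = - (\<nu> * s * (?L / n) * (- \<nu>))"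
          by (simp add: power2_eq_square)
        ultimately have "\<nu> * l - (1 - exp (- \<nu>)) * (s - l) * (?a / (n choose 2)) \<le> - (\<theta>\<^sup>2 / 32 * \<kappa> * (n * ?L))"
          by linarith
        then show ?thesis by simp
      qed
      finally show "measure_pmf.prob (random_graph_process n) {Gs. card (cut A ({..<n} - A) \<inter> Gs ! ?a)
          \<le> (1 - \<theta>) * (card A * (real n - card A)) * (?L / n)} \<le> exp (- (\<theta>\<^sup>2 / 32 * \<kappa>) * (n * ?L))"
        by (simp add: F_def l_def s)
    qed
  qed
qed

text \<open>With \<open>\<mu> = \<theta> / 4\<close>, two factors \<open>1 + \<mu>\<close> arise,
  from \<open>exp \<mu> - 1\<close> and from the density; their product stays below
  \<open>1 + \<theta> = 1 + 4 * \<mu>\<close> by at least \<open>\<mu>\<close>.\<close>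

lemma large_sets_inner_edges:
  assumes \<theta>: "0 < \<theta>" "\<theta> \<le> 1" and \<kappa>: "0 < \<kappa>"
  shows "(\<lambda>n. measure_pmf.prob (random_graph_process n)
     {Gs. \<exists>A\<in>{A. A \<subseteq> {..<n} \<and> \<kappa> * real n \<le> card A}.
        (1 + \<theta>) * ((real (card A))\<^sup>2 / 2) * (ln n / n)
          \<le> card (all_edges A \<inter> Gs ! upper_time (\<theta> / 8) n)}) \<longlonglongrightarrow> 0"
proof (rule prob_subsets_tendsto_0)
  show "0 < \<theta>\<^sup>2 / 32 * \<kappa>\<^sup>2" using assms by simp
  have "eventually (\<lambda>n. 1 \<le> ln (real n)) sequentially" by real_asymp
  moreover have "0 < \<theta> / 8" "\<theta> / 8 < 1" using \<theta> by auto
  note eventually_times[OF this]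
  ultimately show "eventually (\<lambda>n. \<forall>A. A \<subseteq> {..<n} \<and> \<kappa> * real n \<le> card A \<longrightarrow>
     measure_pmf.prob (random_graph_process n) {Gs. (1 + \<theta>) * ((real (card A))\<^sup>2 / 2) * (ln n / n)
          \<le> card (all_edges A \<inter> Gs ! upper_time (\<theta> / 8) n)} \<le> exp (- (\<theta>\<^sup>2 / 32 * \<kappa>\<^sup>2) * (n * ln n))) sequentially"
    using eventually_ge_at_top[of 2]
  proof eventually_elim
    case (elim n)
    let ?b = "upper_time (\<theta> / 8) n" and ?L = "ln (real n)"
    have n: "0 < real n" "0 < ?L" using elim by auto
    show ?case
    proof (intro allI impI)
      fix A assume A: "A \<subseteq> {..<n} \<and> \<kappa> * real n \<le> card A"
      then have finA: "finite A" using finite_subset by auto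
      define s where "s = (real (card A))\<^sup>2 / 2"
      define \<mu> where "\<mu> = \<theta> / 4"
      have \<mu>: "0 \<le> \<mu>" "\<mu> \<le> 1/4" using \<theta> by (auto simp: \<mu>_def)
      have s_ge: "(\<kappa> * n)\<^sup>2 / 2 \<le> s" unfolding s_def using A \<kappa> by (intro divide_right_mono power_mono) auto
      have s0: "0 \<le> s" by (simp add: s_def)
      have "measure_pmf.prob (random_graph_process n) {Gs. (1 + \<theta>) * s * (?L / n) \<le> card (all_edges A \<inter> Gs ! ?b)}
        \<le> exp (- \<mu> * ((1 + \<theta>) * s * (?L / n)) + (exp \<mu> - 1) * card (all_edges A) * (?b / (real (n choose 2) - ?b)))"
        using elim \<mu> A by (intro process_upper_tail all_edges_mono) auto
      also have "\<dots> \<le> exp (- (\<theta>\<^sup>2 / 32 * \<kappa>\<^sup>2) * (n * ?L))"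
      proof -
        have "(exp \<mu> - 1) * card (all_edges A) * (?b / (real (n choose 2) - ?b))
          \<le> (\<mu> * (1 + \<mu>)) * s * ((1 + \<mu>) * (?L / n))"
        proof (intro mult_mono)
          show "exp \<mu> - 1 \<le> \<mu> * (1 + \<mu>)"
            using exp_bound[of \<mu>] \<mu> by (simp add: power2_eq_square algebra_simps)
          show "?b / (real (n choose 2) - ?b) \<le> (1 + \<mu>) * (?L / n)"
            using elim by (simp add: \<mu>_def)
        qed (use \<mu> n s0 elim card_all_edges_le[OF finA] in \<open>auto simp: s_def\<close>)
        moreover have "- \<mu> * ((1 + \<theta>) * s * y) + (\<mu> * (1 + \<mu>)) * s * ((1 + \<mu>) * y)
            = \<mu> * s * y * ((1 + \<mu>)\<^sup>2 - (1 + \<theta>))" for y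
          by (simp add: power2_eq_square algebra_simps)
        note this[of "?L / n"]
        moreover have "\<mu> * s * (?L / n) * ((1 + \<mu>)\<^sup>2 - (1 + \<theta>)) \<le> \<mu> * s * (?L / n) * (- \<mu>)"
        proof (intro mult_left_mono)
          have "(1 + \<mu>)\<^sup>2 - (1 + \<theta>) = - \<mu> - \<mu> * (1 - \<mu>)"
            by (simp add: \<mu>_def power2_eq_square algebra_simps)
          then show "(1 + \<mu>)\<^sup>2 - (1 + \<theta>) \<le> - \<mu>" using \<mu> by simp
        qed (use \<mu> s0 n in auto)
        moreover have "((\<kappa> * n)\<^sup>2 / 2) * (\<mu>\<^sup>2 * (?L / n)) \<le> s * (\<mu>\<^sup>2 * (?L / n))"
          using n by (intro mult_right_mono s_ge) auto
        moreover have "((\<kappa> * n)\<^sup>2 / 2) * (\<mu>\<^sup>2 * (?L / n)) = \<theta>\<^sup>2 / 32 * \<kappa>\<^sup>2 * (n * ?L)"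
          using n by (simp add: \<mu>_def power2_eq_square)
        moreover have "s * (\<mu>\<^sup>2 * (?L / n)) = - (\<mu> * s * (?L / n) * (- \<mu>))"
          by (simp add: power2_eq_square)
        ultimately have "- \<mu> * ((1 + \<theta>) * s * (?L / n)) + (exp \<mu> - 1) * card (all_edges A) * (?b / (real (n choose 2) - ?b))
           \<le> - (\<theta>\<^sup>2 / 32 * \<kappa>\<^sup>2 * (n * ?L))"
          by linarith
        then show ?thesis by simp
      qed
      finally show "measure_pmf.prob (random_graph_process n) {Gs. (1 + \<theta>) * ((real (card A))\<^sup>2 / 2) * (?L / n)
          \<le> card (all_edges A \<inter> Gs ! ?b)} \<le> exp (- (\<theta>\<^sup>2 / 32 * \<kappa>\<^sup>2) * (n * ?L))"
        by (simp add: s_def)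
    qed
  qed
qed

text \<open>
  Second moment method: \<open>q1\<close> and \<open>q2\<close> are the probabilities that one, respectively two given
  vertices are isolated, and \<open>q2 / q1\<^sup>2\<close> tends to \<open>1\<close>.
\<close>

lemma isolated_vertex:
  assumes \<eta>: "0 < \<eta>" "\<eta> < 1"
  shows "(\<lambda>n. measure_pmf.prob (random_graph_process n)
     {Gs. \<not> (\<exists>v\<in>{..<n}. star n v \<inter> Gs ! lower_time \<eta> n = {})}) \<longlonglongrightarrow> 0"
proof -
  define g where "g = (\<lambda>n::nat. (1 - \<eta>) * real n * ln (real n) / 2)"
  have ev1: "eventually (\<lambda>n. g n + 2 * real n < real n * (real n - 1) / 2) sequentially"
    unfolding g_def using \<eta> by real_asymp
  have ev2: "eventually (\<lambda>n. g n * ((real n - 1) / (real n * (real n - 1) / 2 - g n - real n + 1))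
      \<le> (1 - \<eta> / 2) * ln n) sequentially"
    unfolding g_def using \<eta> by real_asymp
  \<comment> \<open>\<open>h n\<close> bounds the logarithm of \<open>q2 / q1\<^sup>2\<close>: there
    are at most \<open>g n\<close> factors, each off by at most \<open>exp z\<close>.\<close>
  define h where "h = (\<lambda>n. g n * ((real n * (real n - 1) / 2) / (real n * (real n - 1) / 2 - g n - real n + 1)\<^sup>2))"
  have "eventually (\<lambda>n. measure_pmf.prob (random_graph_process n)
     {Gs. \<not> (\<exists>v\<in>{..<n}. star n v \<inter> Gs ! lower_time \<eta> n = {})}
     \<le> exp ((1 - \<eta> / 2) * ln n) / n + (exp (h n) - 1)) sequentially"
    using ev1 ev2 eventually_ge_at_top[of 2]
  proof eventually_elim
    case (elim n)
    let ?P = "random_graph_process n" and ?N = "real (n choose 2)"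
    define a where "a = lower_time \<eta> n"
    have n: "2 \<le> n" using elim by simp
    have ag: "a \<le> g n" using lower_time_le n \<eta> by (simp add: a_def g_def)
    have N: "?N = real n * (real n - 1) / 2" by (rule of_nat_choose_two)
    have room: "real a + 2 * n < ?N" using elim(1) ag N by simp
    define q1 where "q1 = (\<Prod>i<a. (?N - real i - (real n - 1)) / (?N - real i))"
    define q2 where "q2 = (\<Prod>i<a. (?N - real i - (2 * real n - 3)) / (?N - real i))"
    define A where "A = (\<lambda>v. {Gs. star n v \<inter> Gs ! a = {}})"
    have A1: "measure_pmf.prob ?P (A v) = q1" if "v < n" for v
      unfolding A_def q1_def using that n room
      by (subst prob_avoid[OF star_subset]) (auto simp: card_star of_nat_diff)
    have A2: "measure_pmf.prob ?P (A u \<inter> A v) = q2" if "u < n" "v < n" "u \<noteq> v" for u v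
    proof -
      have eq: "A u \<inter> A v = {Gs. (star n u \<union> star n v) \<inter> Gs ! a = {}}" by (auto simp: A_def)
      show ?thesis
        unfolding eq q2_def using that n room star_subset
        by (subst prob_avoid) (auto simp: card_star_Un of_nat_diff)
    qed
    have factor: "0 < ?N - real i - real n + 1" "0 < ?N - real i" if "i < a" for i
      using that room by auto
    have q1_pos: "0 < q1"
      unfolding q1_def using factor by (intro prod_pos) (auto simp: algebra_simps)
    have q1_ge: "exp (- (1 - \<eta> / 2) * ln n) \<le> q1"
    proof -
      \<comment> \<open>A factor of \<open>q1\<close> is \<open>1 / (1 + x)\<close> with
        \<open>x = (n - 1) / (?N - i - n + 1)\<close>; \<open>y\<close> bounds this for all
        \<open>i < a\<close>, and \<open>1 / (1 + y) \<ge> exp (- y)\<close>.\<close>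
      define y where "y = (real n - 1) / (?N - g n - real n + 1)"
      have y: "0 \<le> y" using elim(1) n unfolding y_def N by (intro divide_nonneg_pos) auto
      have "exp (- y) \<le> (?N - real i - (real n - 1)) / (?N - real i)" if i: "i < a" for i
      proof -
        have "1 / exp y \<le> 1 / (1 + y)" using y by (intro divide_left_mono exp_ge_add_one_self) auto
        also have "1 / (1 + y) \<le> 1 / (1 + (real n - 1) / (?N - real i - real n + 1))"
        proof -
          have "(real n - 1) / (?N - real i - real n + 1) \<le> y"
            unfolding y_def using i ag elim(1) n N by (intro divide_left_mono) auto
          moreover have "0 \<le> (real n - 1) / (?N - real i - real n + 1)"
            using factor[OF i] n by simp
          ultimately show ?thesis by (intro divide_left_mono) auto
        qed
        also have "\<dots> = (?N - real i - (real n - 1)) / (?N - real i)"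
          using factor[OF i] by (simp add: field_simps)
        finally show ?thesis by (simp add: exp_minus inverse_eq_divide)
      qed
      then have "(\<Prod>i<a. exp (- y)) \<le> q1" unfolding q1_def by (intro prod_mono) auto
      then have "exp (- (a * y)) \<le> q1" by (simp add: exp_of_nat_mult[symmetric])
      moreover have "a * y \<le> (1 - \<eta> / 2) * ln n"
        using mult_right_mono[OF ag y] elim(2) unfolding y_def N by linarith
      ultimately show ?thesis by (smt (verit) exp_le_cancel_iff mult_minus_left)
    qed
    have q2_le: "q2 \<le> q1\<^sup>2 * exp (h n)"
    proof -
      define z where "z = ?N / (?N - g n - real n + 1)\<^sup>2"
      have z: "0 \<le> z" by (simp add: z_def)
      have "(?N - real i - (2 * real n - 3)) / (?N - real i)
          \<le> ((?N - real i - (real n - 1)) / (?N - real i))\<^sup>2 * exp z" if i: "i < a" for i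
      proof -
        define x where "x = ?N - real i"
        define d where "d = x - (real n - 1)"
        have xd: "0 < x" "0 < d" using factor[OF i] by (auto simp: x_def d_def)
        have "(?N - g n - real n + 1)\<^sup>2 \<le> d\<^sup>2"
          using i ag elim(1) N by (intro power_mono) (auto simp: d_def x_def)
        moreover have "0 < (?N - g n - real n + 1)\<^sup>2" using elim(1) N by auto
        ultimately have "x / d\<^sup>2 \<le> z" unfolding z_def x_def by (intro frac_le) auto
        then have 1: "1 + x / d\<^sup>2 \<le> exp z" using exp_ge_add_one_self[of z] by linarith
        \<comment> \<open>The left side equals \<open>d\<^sup>2 + x - (n - 1)\<^sup>2\<close>; the
          surplus \<open>x\<close> arises because the edge joining the two vertices is counted once,
          giving \<open>2 * n - 3\<close> and not \<open>2 * n - 2\<close>.\<close>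
        have "(x - (2 * real n - 3)) * x \<le> d\<^sup>2 + x"
          using zero_le_power2[of "real n - 1"] by (simp add: d_def power2_eq_square algebra_simps)
        then have "(x - (2 * real n - 3)) * x / x\<^sup>2 \<le> (d\<^sup>2 + x) / x\<^sup>2"
          by (rule divide_right_mono) simp
        moreover have "(x - (2 * real n - 3)) * x / x\<^sup>2 = (x - (2 * real n - 3)) / x"
          using xd by (simp add: power2_eq_square)
        ultimately have "(x - (2 * real n - 3)) / x \<le> (d\<^sup>2 + x) / x\<^sup>2" by simp
        also have "\<dots> = (d / x)\<^sup>2 * (1 + x / d\<^sup>2)" using xd by (simp add: field_simps power2_eq_square)
        also have "\<dots> \<le> (d / x)\<^sup>2 * exp z" using 1 by (intro mult_left_mono) auto
        finally show ?thesis by (simp add: d_def x_def)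
      qed
      moreover have "0 \<le> (?N - real i - (2 * real n - 3)) / (?N - real i)" if "i < a" for i
        using that room by (intro divide_nonneg_pos) auto
      ultimately have "q2 \<le> (\<Prod>i<a. ((?N - real i - (real n - 1)) / (?N - real i))\<^sup>2 * exp z)"
        unfolding q2_def by (intro prod_mono) auto
      also have "\<dots> = q1\<^sup>2 * exp (a * z)"
        by (simp add: prod.distrib q1_def prod_power_distrib exp_of_nat_mult)
      also have "\<dots> \<le> q1\<^sup>2 * exp (h n)"
        using mult_right_mono[OF ag z] by (intro mult_left_mono) (auto simp: h_def z_def N)
      finally show ?thesis .
    qed
    define X where "X = (\<lambda>Gs. \<Sum>v<n. indicator (A v) Gs :: real)"
    have int: "integrable (measure_pmf ?P) f" for f :: "_ \<Rightarrow> real"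
      unfolding random_graph_process_def by (rule integrable_random_graph_steps) simp
    have EX: "measure_pmf.expectation ?P X = n * q1"
      unfolding X_def by (subst Bochner_Integration.integral_sum) (auto simp: int A1)
    have EX2: "measure_pmf.expectation ?P (\<lambda>Gs. (X Gs)\<^sup>2) = n * q1 + n * (n - 1) * q2"
    proof -
      have "measure_pmf.expectation ?P (\<lambda>Gs. (X Gs)\<^sup>2)
         = measure_pmf.expectation ?P (\<lambda>Gs. \<Sum>u<n. \<Sum>v<n. indicator (A u \<inter> A v) Gs)"
        by (simp add: X_def power2_eq_square sum_product indicator_inter_arith)
      also have "\<dots> = (\<Sum>u<n. \<Sum>v<n. measure_pmf.prob ?P (A u \<inter> A v))"
        by (subst Bochner_Integration.integral_sum, simp add: int)+ simp
      also have "\<dots> = (\<Sum>u<n. \<Sum>v<n. if u = v then q1 else q2)"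
        by (intro sum.cong refl) (auto simp: A1 A2)
      also have "\<dots> = (\<Sum>u<n. q1 + (n - 1) * q2)"
      proof (rule sum.cong[OF refl])
        fix u assume u: "u \<in> {..<n}"
        have "(\<Sum>v<n. if u = v then q1 else q2) = q1 + (\<Sum>v\<in>{..<n} - {u}. if u = v then q1 else q2)"
          using u by (subst sum.remove[of _ u]) auto
        also have "(\<Sum>v\<in>{..<n} - {u}. if u = v then q1 else q2) = (\<Sum>v\<in>{..<n} - {u}. q2)"
          by (intro sum.cong) auto
        finally show "(\<Sum>v<n. if u = v then q1 else q2) = q1 + (n - 1) * q2" using u by simp
      qed
      finally show ?thesis by (simp add: algebra_simps)
    qed
    let ?B = "{Gs. \<not> (\<exists>v\<in>{..<n}. star n v \<inter> Gs ! a = {})}"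
    \<comment> \<open>Chebyshev: on \<open>?B\<close> no vertex is isolated, so \<open>X\<close> is
      \<open>0\<close> and misses its mean by the full \<open>n * q1\<close>.\<close>
    have "(n * q1)\<^sup>2 * measure_pmf.prob ?P ?B = measure_pmf.expectation ?P (\<lambda>Gs. (n * q1)\<^sup>2 * indicator ?B Gs)"
      by simp
    also have "\<dots> \<le> measure_pmf.expectation ?P (\<lambda>Gs. (X Gs)\<^sup>2 - 2 * (n * q1) * X Gs + (n * q1)\<^sup>2)"
    proof (rule integral_mono[OF int int])
      fix Gs
      have "0 \<le> (X Gs - n * q1)\<^sup>2" by simp
      moreover have "X Gs = 0" if "Gs \<in> ?B" using that by (auto simp: X_def A_def)
      ultimately show "(n * q1)\<^sup>2 * indicator ?B Gs \<le> (X Gs)\<^sup>2 - 2 * (n * q1) * X Gs + (n * q1)\<^sup>2"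
        by (auto simp: indicator_def power2_diff mult_ac)
    qed
    also have "\<dots> = n * q1 + n * (n - 1) * q2 - (n * q1)\<^sup>2"
      by (simp add: int EX EX2) (simp add: power2_eq_square)
    also have "\<dots> \<le> n * q1 + n\<^sup>2 * (q1\<^sup>2 * exp (h n)) - (n * q1)\<^sup>2"
    proof -
      have "0 \<le> q2" unfolding q2_def using room by (intro prod_nonneg divide_nonneg_pos) auto
      then have "real (n * (n - 1)) * q2 \<le> real (n\<^sup>2) * (q1\<^sup>2 * exp (h n))"
        using q2_le by (intro mult_mono) (auto simp: power2_eq_square intro!: mult_left_mono)
      then show ?thesis by simp
    qed
    also have "\<dots> = (n * q1)\<^sup>2 * (1 / (n * q1) + (exp (h n) - 1))"
      using q1_pos n by (simp add: field_simps power2_eq_square)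
    finally have "measure_pmf.prob ?P ?B \<le> 1 / (n * q1) + (exp (h n) - 1)"
      using q1_pos n by (simp add: mult_le_cancel_left_pos)
    \<comment> \<open>The mean \<open>n * q1\<close> is at least \<open>n\<close> to the power
      \<open>\<eta> / 2\<close>, hence unbounded.\<close>
    also have "1 / (n * q1) \<le> 1 / (n * exp (- (1 - \<eta> / 2) * ln n))"
      using q1_ge q1_pos n by (intro divide_left_mono mult_left_mono mult_pos_pos) auto
    also have "1 / (n * exp (- (1 - \<eta> / 2) * ln n)) = exp ((1 - \<eta> / 2) * ln n) / n"
      by (simp add: exp_minus field_simps)
    finally show ?case by (simp add: a_def)
  qed
  moreover have "(\<lambda>n. exp ((1 - \<eta> / 2) * ln n) / n + (exp (h n) - 1)) \<longlonglongrightarrow> 0"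
    unfolding h_def g_def using \<eta> by real_asymp
  ultimately show ?thesis by (rule prob_tendsto_0)
qed

subsection \<open>The hitting time\<close>

lemma prob_Un_tendsto_0:
  assumes "((\<lambda>n. measure_pmf.prob (p n) (A n)) \<longlongrightarrow> 0) F" "((\<lambda>n. measure_pmf.prob (p n) (B n)) \<longlongrightarrow> 0) F"
  shows "((\<lambda>n. measure_pmf.prob (p n) (A n \<union> B n)) \<longlongrightarrow> 0) F"
  by (rule prob_tendsto_0[OF _ tendsto_add_zero[OF assms]]) (simp add: measure_Un_le)

text \<open>Outside the bad event only lists in the support are considered, where trajectory facts
  make the argument deterministic.\<close>

lemma prob_tendsto_1:
  assumes "((\<lambda>n. measure_pmf.prob (p n) (B n)) \<longlongrightarrow> 0) F"
    and "eventually (\<lambda>n. set_pmf (p n) - B n \<subseteq> A n) F"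
  shows "((\<lambda>n. measure_pmf.prob (p n) (A n)) \<longlongrightarrow> 1) F"
proof (rule tendsto_sandwich)
  show "eventually (\<lambda>n. 1 - measure_pmf.prob (p n) (B n) \<le> measure_pmf.prob (p n) (A n)) F"
    using assms(2)
  proof eventually_elim
    case (elim n)
    have "1 = measure_pmf.prob (p n) (set_pmf (p n))" by (simp add: measure_pmf.prob_eq_1 AE_measure_pmf)
    also have "\<dots> \<le> measure_pmf.prob (p n) (A n \<union> B n)"
      using elim by (intro measure_pmf.finite_measure_mono) auto
    also have "\<dots> \<le> measure_pmf.prob (p n) (A n) + measure_pmf.prob (p n) (B n)"
      by (rule measure_Un_le) auto
    finally show ?case by simp
  qed
  show "((\<lambda>n. 1 - measure_pmf.prob (p n) (B n)) \<longlongrightarrow> 1) F"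
    using tendsto_diff[OF tendsto_const assms(1), of 1] by simp
qed (auto intro: tendsto_const)

lemma min_degree_ge_iff:
  assumes "finite V" "V \<noteq> {}"
  shows "d \<le> min_degree V E \<longleftrightarrow> (\<forall>v\<in>V. d \<le> degree E v)"
  using assms by (simp add: min_degree_def)

text \<open>At time \<open>b\<close> the degree condition holds, so the \<open>LEAST\<close> is
  attained and at most \<open>b\<close>. Before \<open>a\<close> the graph is contained in the one
  at \<open>a\<close>, so \<open>v\<close> would still be isolated, against
  \<open>0 < d\<close>.\<close>

lemma min_degree_time_between:
  assumes tr: "trajectory n N Gs" and n: "0 < n" and ab: "a \<le> b" "b \<le> N" and d: "0 < d"
    and isolated: "v < n" "degree (Gs ! a) v = 0"
    and full: "\<And>v. v < n \<Longrightarrow> d \<le> degree (Gs ! b) v"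
  shows "a \<le> min_degree_time d {..<n} Gs" "min_degree_time d {..<n} Gs \<le> b"
    "\<And>v. v < n \<Longrightarrow> d \<le> degree (Gs ! min_degree_time d {..<n} Gs) v"
proof -
  let ?P = "\<lambda>m. m < length Gs \<and> min_degree {..<n} (Gs ! m) \<ge> d"
  let ?t = "min_degree_time d {..<n} Gs"
  have iff: "d \<le> min_degree {..<n} E \<longleftrightarrow> (\<forall>v<n. d \<le> degree E v)" for E
    using n by (subst min_degree_ge_iff) auto
  have "?P b" using full ab tr by (simp add: iff trajectory_def)
  then have t: "?P ?t" "?t \<le> b" unfolding min_degree_time_def by (rule LeastI, rule Least_le)
  then show "?t \<le> b" and deg: "\<And>v. v < n \<Longrightarrow> d \<le> degree (Gs ! ?t) v" by (auto simp: iff)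
  show "a \<le> ?t"
  proof (rule ccontr)
    assume "\<not> a \<le> ?t"
    then have "Gs ! ?t \<subseteq> Gs ! a" using ab by (intro trajectory_mono[OF tr]) auto
    moreover have "finite (Gs ! a)"
      using tr ab finite_subset[OF _ finite_all_edges[of "{..<n}"]] by (auto simp: trajectory_def)
    ultimately have "degree (Gs ! ?t) v \<le> degree (Gs ! a) v"
      unfolding degree_def by (intro card_mono) auto
    then show False using deg[OF isolated(1)] isolated(2) d by simp
  qed
qed

theorem corollary1p7:
  fixes k :: nat and \<epsilon> :: real
  assumes "k \<ge> 2" and "\<epsilon> > 0"
  shows "(\<lambda>n. measure_pmf.prob (random_graph_process n)
            {Gs. resilient (1/2 - \<epsilon>) (k_connected k) {..<n}
                   (Gs ! min_degree_time (2 * k - 2) {..<n} Gs)}) \<longlonglongrightarrow> 1"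
proof -
  \<comment> \<open>The cap makes \<open>1 - 2 * e\<close> nonnegative and
    \<open>\<eta> \<le> 1/32\<close>; \<open>\<eta> = e / 8\<close> is the time parameter of the
    large-set bounds for \<open>\<theta> = e\<close>.\<close>
  define e where "e = min \<epsilon> (1/4)"
  define \<eta> where "\<eta> = e / 8"
  have e: "0 < e" "e \<le> 1/4" "e \<le> \<epsilon>" and \<eta>: "0 < \<eta>" "\<eta> \<le> 1/32" "\<eta> < 1" "\<eta> \<le> 1/2"
    using assms(2) by (auto simp: e_def \<eta>_def)
  \<comment> \<open>\<open>10 * \<delta> \<le> \<gamma>\<close> has to hold with
    \<open>\<gamma> = 1/100\<close>, and \<open>\<kappa>\<close> is the size limit up to which sets
    are sparse for this \<open>\<delta>\<close>.\<close>
  define \<delta> \<kappa> :: real where "\<delta> = 1/1000" and "\<kappa> = exp (- 4 / \<delta>)"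
  have \<delta>: "0 < \<delta>" and \<kappa>: "0 < \<kappa>" by (auto simp: \<delta>_def \<kappa>_def)
  have e1: "e \<le> 1" using e by simp
  \<comment> \<open>The union of seven bad events. Degrees are integers, so exceeding
    \<open>2 * k - 3\<close> means reaching \<open>2 * k - 2\<close>.\<close>
  note bad = prob_Un_tendsto_0[OF isolated_vertex[OF \<eta>(1,3)]
      prob_Un_tendsto_0[OF min_degree_bound[OF \<eta>(1,3), of "real (2 * k - 3)"]
      prob_Un_tendsto_0[OF low_degree_nonadjacent[OF \<eta>(1,2)]
      prob_Un_tendsto_0[OF low_degree_no_common_neighbour[OF \<eta>(1,2)]
      prob_Un_tendsto_0[OF small_sets_sparse[OF \<eta>(1,4) \<delta>, folded \<kappa>_def]
      prob_Un_tendsto_0[OF large_sets_cut[OF e(1) e1 \<kappa>, folded \<eta>_def]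
        large_sets_inner_edges[OF e(1) e1 \<kappa>, folded \<eta>_def]]]]]]]
  have large_n: "eventually (\<lambda>n. 2 * (real k - 1) \<le> \<delta> * ln n) sequentially" using \<delta> by real_asymp
  \<comment> \<open>Makes the \<open>(real k - 1) * card A\<close> edges allowed for the deleted
    vertices smaller than the gap \<open>e * ln n / 2 * card A\<close> found in
    \<open>expand\<close>.\<close>
  have larger_n: "eventually (\<lambda>n. 2 * (real k - 1) < e * ln n) sequentially" using e(1) by real_asymp
  show ?thesis
  proof (rule prob_tendsto_1[OF bad], goal_cases)
    case 1
    show ?case
      using large_n larger_n eventually_times[OF \<eta>(1,3)] eventually_ge_at_top[of 2]
    proof eventually_elim
      case (elim n)
      show ?case
      proof (intro subsetI CollectI, goal_cases)
        case (1 Gs)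
        let ?a = "lower_time \<eta> n" and ?b = "upper_time \<eta> n" and ?L = "ln (real n)"
        define t where "t = min_degree_time (2 * k - 2) {..<n} Gs"
        have n: "0 < real n" "0 < ?L" using elim(4) by auto
        have ab: "?a \<le> ?b" "?b < n choose 2" using elim(3) by auto
        note good = 1[unfolded Diff_iff Un_iff de_Morgan_disj mem_Collect_eq not_not]
        note g1 = good[THEN conjunct2, THEN conjunct1]
        note r2 = good[THEN conjunct2, THEN conjunct2]
        note g2 = r2[THEN conjunct1] and r3 = r2[THEN conjunct2]
        note g3 = r3[THEN conjunct1] and r4 = r3[THEN conjunct2]
        note g4 = r4[THEN conjunct1] and r5 = r4[THEN conjunct2]
        note g5 = r5[THEN conjunct1] and r6 = r5[THEN conjunct2]
        note g6 = r6[THEN conjunct1] and g7 = r6[THEN conjunct2]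
        have tr: "trajectory n (n choose 2) Gs"
          using good[THEN conjunct1] by (auto simp: random_graph_process_def intro: set_random_graph_steps)
        have sub: "Gs ! i \<subseteq> all_edges {..<n}" if "i \<le> n choose 2" for i
          using tr that by (simp add: trajectory_def)
        have deg: "degree (Gs ! ?a) v = card (star n v \<inter> Gs ! ?a)" "degree (Gs ! ?b) v = card (star n v \<inter> Gs ! ?b)" for v
          using ab sub by (simp_all add: degree_eq_card_star)
        obtain v where v: "v < n" "star n v \<inter> Gs ! ?a = {}" using g1 by auto
        have full: "2 * k - 2 \<le> degree (Gs ! ?b) w" if "w < n" for w
        proof -
          have "\<not> real (card (star n w \<inter> Gs ! ?b)) \<le> real (2 * k - 3)" using g2 that by blast
          then show ?thesis using assms(1) by (simp add: deg)
        qed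
        have nonadj: "{u, w} \<notin> Gs ! ?b"
          if "u < n" "w < n" "u \<noteq> w" "degree (Gs ! ?a) u \<le> 1/100 * ?L" "degree (Gs ! ?a) w \<le> 1/100 * ?L" for u w
          using g3 that unfolding deg by blast
        have noncommon: "{w, x} \<notin> Gs ! ?b"
          if *: "u < n" "w < n" "u \<noteq> w" "degree (Gs ! ?a) u \<le> 1/100 * ?L" "degree (Gs ! ?a) w \<le> 1/100 * ?L"
            and x: "{u, x} \<in> Gs ! ?b" for u w x
        proof
          assume wx: "{w, x} \<in> Gs ! ?b"
          \<comment> \<open>Edges have two distinct ends, which supplies the distinctness that
            \<open>g4\<close> asks of the triple.\<close>
          have "{u, x} \<in> all_edges {..<n}" "{w, x} \<in> all_edges {..<n}" using x wx sub[of ?b] ab(2) by auto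
          then have "x < n" "u \<noteq> x" "w \<noteq> x" by (auto simp: all_edges_def)
          then show False using g4 * x wx unfolding deg by blast
        qed
        have sparse: "card (all_edges A \<inter> Gs ! ?b) \<le> \<delta> * card A * ?L"
          if "A \<subseteq> {..<n}" "A \<noteq> {}" "\<not> \<kappa> * n \<le> card A" for A
        proof -
          have "A \<in> {A. A \<subseteq> {..<n} \<and> A \<noteq> {} \<and> real (card A) \<le> \<kappa> * real n}" using that by simp
          then show ?thesis using g5 by (meson linorder_linear)
        qed
        have expand: "(1 - 2 * e) * card (all_edges A \<inter> Gs ! ?b) + (real k - 1) * card A
             < (1/2 + e) * card (cut A ({..<n} - A) \<inter> Gs ! ?a)"
          if A: "A \<subseteq> {..<n}" "\<kappa> * n \<le> card A" "2 * card A \<le> card {..<n}" for A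
        proof -
          let ?s = "real (card A)"
          have "0 < \<kappa> * n" using \<kappa> n by simp
          then have s: "0 < ?s" "?s \<le> n / 2" using A(2,3) unfolding card_lessThan by linarith+
          have "\<not> (1 + e) * (?s\<^sup>2 / 2) * (?L / n) \<le> card (all_edges A \<inter> Gs ! ?b)"
            using g7 A by blast
          then have "card (all_edges A \<inter> Gs ! ?b) \<le> (1 + e) * (?s\<^sup>2 / 2) * (?L / n)" by linarith
          also have "\<dots> = (1 + e) * (?s / 2) * (?L / n) * ?s" by (simp add: power2_eq_square)
          also have "\<dots> \<le> (1 + e) * (?s / 2) * (?L / n) * (n / 2)"
            using s n e by (intro mult_left_mono) auto
          also have "\<dots> = (1 + e) * (?s * ?L / 4)" using n by simp
          finally have inner: "(1 - 2 * e) * card (all_edges A \<inter> Gs ! ?b) \<le> (1 - 2 * e) * ((1 + e) * (?s * ?L / 4))"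
            using e by (intro mult_left_mono) auto
          have "\<not> card (cut A ({..<n} - A) \<inter> Gs ! ?a) \<le> (1 - e) * (?s * (real n - ?s)) * (?L / n)"
            using g6 A unfolding card_lessThan by blast
          then have cut: "(1 - e) * (?s * (real n - ?s)) * (?L / n) \<le> card (cut A ({..<n} - A) \<inter> Gs ! ?a)"
            by linarith
          have "(1/2 + e) * ((1 - e) * (?s * ?L / 2)) \<le> (1/2 + e) * card (cut A ({..<n} - A) \<inter> Gs ! ?a)"
          proof (rule mult_left_mono)
            have "(1 - e) * (?s * ?L / 2) = (1 - e) * (?s * (n / 2)) * (?L / n)" using n by simp
            also have "\<dots> \<le> (1 - e) * (?s * (real n - ?s)) * (?L / n)"
              using s n e by (intro mult_right_mono mult_left_mono) auto
            also note cut
            finally show "(1 - e) * (?s * ?L / 2) \<le> card (cut A ({..<n} - A) \<inter> Gs ! ?a)" .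
          qed (use e in auto)
          \<comment> \<open>As \<open>?s \<le> n / 2\<close>, there are at most
            \<open>(1 + e) * (?s * ?L / 4)\<close> inner edges and at least
            \<open>(1 - e) * (?s * ?L / 2)\<close> leaving ones. Weighted as in
            \<open>expand\<close>, the \<open>e\<^sup>2\<close> terms of the two bounds cancel and
            the gap is exactly \<open>e * ?L / 2 * ?s\<close>.\<close>
          moreover have "(1 - 2 * e) * ((1 + e) * (?s * ?L / 4)) + e * ?L / 2 * ?s = (1/2 + e) * ((1 - e) * (?s * ?L / 2))"
            by (simp add: field_simps)
          moreover have "(real k - 1) * ?s < e * ?L / 2 * ?s"
            using elim(2) s by (intro mult_strict_right_mono) auto
          ultimately show ?thesis using inner by linarith
        qed
        have d: "0 < 2 * k - 2" using assms(1) by simp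
        have iso: "degree (Gs ! ?a) v = 0" using v by (simp add: deg)
        have n0: "0 < n" using n by simp
        note time = min_degree_time_between[OF tr n0 ab(1) less_imp_le[OF ab(2)] d v(1) iso full, folded t_def]
        \<comment> \<open>The criterion is applied with the capped \<open>e\<close>;
          antimonotonicity then returns to \<open>\<epsilon>\<close>.\<close>
        have "resilient (1/2 - e) (k_connected k) {..<n} (Gs ! t)"
        proof (rule resilientI[where ?G0.0 = "Gs ! ?a" and ?G1.0 = "Gs ! ?b" and \<gamma> = "1/100" and L = ?L
              and \<delta> = \<delta> and large = "\<lambda>A. \<kappa> * n \<le> card A"])
          show "Gs ! t \<subseteq> all_edges {..<n}" using sub time ab by simp
          show "Gs ! ?a \<subseteq> Gs ! t" "Gs ! t \<subseteq> Gs ! ?b"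
            by (rule trajectory_mono[OF tr]; use time ab in simp)+
          show "2 * k - 2 \<le> degree (Gs ! t) v" if "v \<in> {..<n}" for v
            using time(3) that by simp
          show "{u, v} \<notin> Gs ! ?b"
            if "u \<in> {..<n}" "v \<in> {..<n}" "u \<noteq> v" "degree (Gs ! ?a) u \<le> 1/100 * ?L" "degree (Gs ! ?a) v \<le> 1/100 * ?L"
            for u v using nonadj that by blast
          show "{v, w} \<notin> Gs ! ?b"
            if "u \<in> {..<n}" "v \<in> {..<n}" "u \<noteq> v" "degree (Gs ! ?a) u \<le> 1/100 * ?L" "degree (Gs ! ?a) v \<le> 1/100 * ?L"
              "{u, w} \<in> Gs ! ?b" for u v w using noncommon that by blast
        qed (fact sparse expand elim(1) assms(1) | use e n in \<open>simp add: \<delta>_def\<close>)+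
        then show ?case
          unfolding t_def[symmetric] by (rule resilient_antimono[rotated]) (use e(3) in simp)
      qed
    qed
  qed
qed

end
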